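(* Let $R$ be a noetherian integral domain with prime subring $Z$, such that $\mathrm{tr.deg}_Z(R)=n<\aleph_0$, and let $X$ be a transcendence basis for $R$ over $Z$. Assume that $Z[X]\subseteq R$ is a residually algebraic extension and that at least one of the following holds. (1) $\mathrm{Char}(R)=0$, $n\geq 1$, and $\mathrm{ht}(M)\geq n+1$ for every maximal ideal $M$ of $R$. (2) $\mathrm{Char}(R)=p>0$, $n\geq 2$, and $\mathrm{ht}(M)\geq n$ for every maximal ideal $M$ of $R$. Then $R$ is submaximal.
   Context: All rings are commutative with $1\neq 0$, and a subring of a ring contains the identity of that ring. A maximal subring of $R$ is a proper subring $S\subsetneq R$ such that there is no subring strictly between $S$ and $R$; $R$ is called submaximal if it has at least one maximal subring. The prime subring of $R$ is $Z=\{m\cdot 1_R\mid m\in\mathbb{Z}\}$. A transcendence basis of an integral domain $R$ over a subring $Z$ is a subset $X\subseteq R$ which is algebraically independent over $Z$ and such that $R$ is algebraic over $Z[X]$; its cardinality equals the transcendence degree of the quotient field of $R$ over that of $Z$, and is denoted $\mathrm{tr.deg}_Z(R)$. An extension $A\subseteq T$ of rings is residually algebraic if for every prime ideal $Q$ of $T$, the ring $T/Q$ is algebraic over $A/(Q\cap A)$. $\mathrm{ht}(M)$ is the height of $M$. *)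

theory Defs
  imports "HOL-Algebra.Algebra" "HOL-Library.Extended_Nat"
begin

section \<open>Maximal subrings\<close>

definition maximal_subring :: "'a set \<Rightarrow> ('a, 'b) ring_scheme \<Rightarrow> bool" where
  "maximal_subring S R \<longleftrightarrow>
     subring S R \<and> S \<noteq> carrier R \<and>
     (\<forall>T. subring T R \<and> S \<subseteq> T \<longrightarrow> T = S \<or> T = carrier R)"

definition submaximal :: "('a, 'b) ring_scheme \<Rightarrow> bool" where
  "submaximal R \<longleftrightarrow> (\<exists>S. maximal_subring S R)"


section \<open>Prime subring and characteristic\<close>

definition prime_subring :: "('a, 'b) ring_scheme \<Rightarrow> 'a set" where
  "prime_subring R = {[m] \<cdot>\<^bsub>R\<^esub> \<one>\<^bsub>R\<^esub> | m :: int. True}"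

definition ring_char :: "('a, 'b) ring_scheme \<Rightarrow> nat" where
  "ring_char R =
     (if \<exists>k::nat. k > 0 \<and> [k] \<cdot>\<^bsub>R\<^esub> \<one>\<^bsub>R\<^esub> = \<zero>\<^bsub>R\<^esub>
      then LEAST k::nat. k > 0 \<and> [k] \<cdot>\<^bsub>R\<^esub> \<one>\<^bsub>R\<^esub> = \<zero>\<^bsub>R\<^esub>
      else 0)"


section \<open>Algebraic independence and transcendence bases\<close>

text \<open>
  An indexed polynomial maps each monomial, a multiset of variables, to its coefficient.
  Here the variables are elements of the ring, and each is evaluated at itself.
\<close>

definition indexed_poly_value :: "('a, 'b) ring_scheme \<Rightarrow> ('a multiset \<Rightarrow> 'a) \<Rightarrow> 'a" where
  "indexed_poly_value R P =
     (\<Oplus>\<^bsub>R\<^esub> m \<in> {m. P m \<noteq> \<zero>\<^bsub>R\<^esub>}.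
        P m \<otimes>\<^bsub>R\<^esub> (\<Otimes>\<^bsub>R\<^esub> x \<in> set_mset m. x [^]\<^bsub>R\<^esub> count m x))"

definition alg_independent :: "('a, 'b) ring_scheme \<Rightarrow> 'a set \<Rightarrow> 'a set \<Rightarrow> bool" where
  "alg_independent R A B \<longleftrightarrow>
     B \<subseteq> carrier R \<and>
     (\<forall>P \<in> ring.indexed_pset R B A.
        indexed_poly_value R P = \<zero>\<^bsub>R\<^esub> \<longrightarrow> (\<forall>m. P m = \<zero>\<^bsub>R\<^esub>))"

definition adjoin :: "('a, 'b) ring_scheme \<Rightarrow> 'a set \<Rightarrow> 'a set \<Rightarrow> 'a set" where
  "adjoin R A B = generate_ring R (A \<union> B)"

definition algebraic_extension :: "'a set \<Rightarrow> ('a, 'b) ring_scheme \<Rightarrow> bool" where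
  "algebraic_extension A T \<longleftrightarrow>
     subring A T \<and> (\<forall>x \<in> carrier T. ring.algebraic T A x)"

definition transcendence_basis :: "('a, 'b) ring_scheme \<Rightarrow> 'a set \<Rightarrow> 'a set \<Rightarrow> bool" where
  "transcendence_basis R A B \<longleftrightarrow>
     alg_independent R A B \<and> algebraic_extension (adjoin R A B) R"

text \<open>
  All transcendence bases of a domain over a subring have the same cardinality,
  so at most one \<open>n\<close> satisfies the following for given \<open>R\<close> and \<open>A\<close>.
\<close>

definition has_trdeg :: "('a, 'b) ring_scheme \<Rightarrow> 'a set \<Rightarrow> nat \<Rightarrow> bool" where
  "has_trdeg R A n \<longleftrightarrow> (\<exists>Y. transcendence_basis R A Y \<and> finite Y \<and> card Y = n)"


section \<open>Residually algebraic extensions\<close>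

text \<open>
  The ring \<open>A / (Q \<inter> A)\<close> is identified with its canonical image in \<open>T / Q\<close>,
  which consists of the cosets \<open>Q + a\<close> with \<open>a \<in> A\<close>.
\<close>

definition residually_algebraic :: "'a set \<Rightarrow> ('a, 'b) ring_scheme \<Rightarrow> bool" where
  "residually_algebraic A T \<longleftrightarrow>
     subring A T \<and>
     (\<forall>Q. primeideal Q T \<longrightarrow>
        algebraic_extension ((\<lambda>a. Q +>\<^bsub>T\<^esub> a) ` A) (T Quot Q))"


section \<open>Height\<close>

definition prime_chain_to ::
    "('a, 'b) ring_scheme \<Rightarrow> 'a set \<Rightarrow> nat \<Rightarrow> (nat \<Rightarrow> 'a set) \<Rightarrow> bool" where
  "prime_chain_to R P k C \<longleftrightarrow>
     (\<forall>i\<le>k. primeideal (C i) R) \<and> (\<forall>i<k. C i \<subset> C (Suc i)) \<and> C k = P"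

definition height :: "('a, 'b) ring_scheme \<Rightarrow> 'a set \<Rightarrow> enat" where
  "height R P = (SUP k \<in> {k. \<exists>C. prime_chain_to R P k C}. enat k)"

end

(*
Either hypothesis yields a maximal ideal M of height at least 2. A proper subring of R over which
R is finitely generated lies in a maximal one, by Zorn's lemma, and maximal subrings pull back
along surjections.

If the field k = R/M is not algebraic over a finite prime field, then k has a rank one valuation
ring, which is a maximal subring of k. Otherwise k has characteristic p > 0 and every x in k
satisfies x^(p^m) = x for some m > 0. Put I = M^2 + pR. If I = M, then M R_M = p R_M by Nakayama's
lemma, so M has height at most 1, a contradiction. Hence I is a proper subset of M. The elements
of R/I fixed by some power of the Frobenius map form a coefficient field of R/I, whose preimage S
in R satisfies R = S + M and S Int M = I. So S is a proper subring, and R is generated over S by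
generators of M, because M^2 is contained in S.
*)

theory Submission
  imports Defs
begin

section \<open>Existence of maximal subrings\<close>

text \<open>A subring S of a field k that is maximal among those containing u but not 1/u is a
  valuation ring by Chevalley's argument, yet it need not be a maximal subring. The obstacle is to
  choose a base ring D inside S so that S[1/u] is forced to be all of k. If k is algebraic over Q,
  then u = 2 and D = Z work, because the odd integers are already units of S. For a transcendental
  u, take D = K[u] with K maximal among the subrings over which u stays transcendental; an element
  outside S[1/u] would allow K to be enlarged.

  The Frobenius map splits R/I because its powers kill M/I, as M^2 lies in I, while a fixed element
  is recovered from its own power. The summand pR of I makes Frobenius additive on R/I even when R
  has characteristic 0. It is also why height 1 does not suffice: in a ring such as the localization
  of Z at p, M equals M^2 + pR.

  The height bound is proved without forming R_M: denominators s outside M are carried along, and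
  the ascending chain of the ideals (yR : q^n) takes the place of Krull's intersection
  theorem.\<close>

lemma subring_Union_chain:
  assumes "ring R" and "\<C> \<noteq> {}" and "subset.chain \<A> \<C>"
    and "\<And>T. T \<in> \<C> \<Longrightarrow> subring T R"
  shows "subring (\<Union>\<C>) R"
proof (rule ring.subringI[OF assms(1)])
  have common: "\<exists>T\<in>\<C>. x \<in> T \<and> y \<in> T" if xy: "x \<in> \<Union>\<C>" "y \<in> \<Union>\<C>" for x y
  proof -
    obtain T U where "T \<in> \<C>" "U \<in> \<C>" "x \<in> T" "y \<in> U"
      using xy by blast
    moreover from this have "T \<subseteq> U \<or> U \<subseteq> T"
      using assms(3) unfolding subset.chain_def by blast
    ultimately show ?thesis
      by blast
  qed
  show "\<Union>\<C> \<subseteq> carrier R"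
    using subringE(1)[OF assms(4)] by blast
  show "\<one>\<^bsub>R\<^esub> \<in> \<Union>\<C>"
    using subringE(3)[OF assms(4)] assms(2) by blast
  show "\<ominus>\<^bsub>R\<^esub> x \<in> \<Union>\<C>" if "x \<in> \<Union>\<C>" for x
    using that subringE(5)[OF assms(4)] by blast
  show "x \<otimes>\<^bsub>R\<^esub> y \<in> \<Union>\<C>" if "x \<in> \<Union>\<C>" "y \<in> \<Union>\<C>" for x y
    using common[OF that] subringE(6)[OF assms(4)] by blast
  show "x \<oplus>\<^bsub>R\<^esub> y \<in> \<Union>\<C>" if "x \<in> \<Union>\<C>" "y \<in> \<Union>\<C>" for x y
    using common[OF that] subringE(7)[OF assms(4)] by blast
qed

text \<open>Zorn's lemma is applied to the subrings that contain \<open>S\<close> but not all of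
  \<open>F\<close>. Finiteness of \<open>F\<close> keeps this family closed under unions of chains:
  a chain whose union contains \<open>F\<close> has a member containing \<open>F\<close>. A subring
  strictly above a maximal member contains \<open>F\<close> and is therefore everything.\<close>

lemma submaximal_if_finitely_generated_over_proper_subring:
  assumes R: "ring R" and S: "subring S R" "S \<noteq> carrier R" and F: "finite F" "F \<subseteq> carrier R"
    and gen: "\<And>T. subring T R \<Longrightarrow> S \<subseteq> T \<Longrightarrow> F \<subseteq> T \<Longrightarrow> T = carrier R"
  shows "submaximal R"
proof -
  define \<A> where "\<A> = {T. subring T R \<and> S \<subseteq> T \<and> \<not> F \<subseteq> T}"
  have "S \<in> \<A>"
    using S gen unfolding \<A>_def by blast
  have "\<exists>M\<in>\<A>. \<forall>Y\<in>\<A>. M \<subseteq> Y \<longrightarrow> Y = M"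
  proof (rule subset_Zorn_nonempty)
    show "\<A> \<noteq> {}"
      using \<open>S \<in> \<A>\<close> by blast
    fix \<C> assume \<C>: "\<C> \<noteq> {}" "subset.chain \<A> \<C>"
    have sub: "\<C> \<subseteq> \<A>"
      using \<C>(2) unfolding subset.chain_def by blast
    have "subring (\<Union>\<C>) R"
      using subring_Union_chain[OF R \<C>] sub unfolding \<A>_def by blast
    moreover have "S \<subseteq> \<Union>\<C>"
      using sub \<C>(1) unfolding \<A>_def by blast
    moreover have "\<not> F \<subseteq> \<Union>\<C>"
    proof
      assume "F \<subseteq> \<Union>\<C>"
      then obtain T where "T \<in> \<C>" "F \<subseteq> T"
        using finite_subset_Union_chain[OF F(1) _ \<C>] by metis
      then show False
        using sub unfolding \<A>_def by blast
    qed
    ultimately show "\<Union>\<C> \<in> \<A>"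
      unfolding \<A>_def by blast
  qed
  then obtain M where "M \<in> \<A>" and max: "\<forall>Y\<in>\<A>. M \<subseteq> Y \<longrightarrow> Y = M"
    by blast
  then have M: "subring M R" "S \<subseteq> M" "\<not> F \<subseteq> M"
    unfolding \<A>_def by simp_all
  have "M \<noteq> carrier R"
    using M(3) F(2) by blast
  moreover have "T = M \<or> T = carrier R" if "subring T R" "M \<subseteq> T" for T
  proof (cases "F \<subseteq> T")
    case True
    then show ?thesis
      using gen[OF that(1)] that(2) M(2) by simp
  next
    case False
    then have "T \<in> \<A>"
      using that M(2) unfolding \<A>_def by simp
    then show ?thesis
      using max that(2) by blast
  qed
  ultimately show ?thesis
    unfolding submaximal_def maximal_subring_def using M(1) by blast
qed

text \<open>The preimage of a maximal subring is maximal: a subring above it contains the kernel of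
  \<open>h\<close>, hence is the full preimage of its own image, and that image leaves only two
  possibilities.\<close>

lemma submaximal_surj_hom:
  assumes "ring_hom_ring R A h" and surj: "h ` carrier R = carrier A" and "submaximal A"
  shows "submaximal R"
proof -
  interpret ring_hom_ring R A h by fact
  obtain S where S: "subring S A" "S \<noteq> carrier A"
    and max: "\<And>T. subring T A \<Longrightarrow> S \<subseteq> T \<Longrightarrow> T = S \<or> T = carrier A"
    using assms(3) unfolding submaximal_def maximal_subring_def by blast
  define S' where "S' = {x \<in> carrier R. h x \<in> S}"
  have "subring S' R"
  proof (rule R.subringI)
    show "S' \<subseteq> carrier R"
      unfolding S'_def by blast
    show "\<one>\<^bsub>R\<^esub> \<in> S'"
      using subringE(3)[OF S(1)] unfolding S'_def by simp
    show "\<ominus>\<^bsub>R\<^esub> x \<in> S'" if "x \<in> S'" for x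
      using that subringE(5)[OF S(1)] unfolding S'_def by simp
    show "x \<otimes>\<^bsub>R\<^esub> y \<in> S'" if "x \<in> S'" "y \<in> S'" for x y
      using that subringE(6)[OF S(1)] unfolding S'_def by simp
    show "x \<oplus>\<^bsub>R\<^esub> y \<in> S'" if "x \<in> S'" "y \<in> S'" for x y
      using that subringE(7)[OF S(1)] unfolding S'_def by simp
  qed
  moreover have "S' \<noteq> carrier R"
  proof
    assume "S' = carrier R"
    then have "h ` carrier R \<subseteq> S"
      unfolding S'_def by blast
    then show False
      using S surj subringE(1)[OF S(1)] by simp
  qed
  moreover have "T = S' \<or> T = carrier R" if T: "subring T R" "S' \<subseteq> T" for T
  proof -
    note TE = subringE[OF T(1)]
    have "subring (h ` T) A"
      using img_is_subring[OF T(1)] .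
    moreover have "S \<subseteq> h ` T"
    proof
      fix s assume "s \<in> S"
      then obtain x where "x \<in> carrier R" "s = h x"
        using surj subringE(1)[OF S(1)] by blast
      then show "s \<in> h ` T"
        using T(2) \<open>s \<in> S\<close> unfolding S'_def by blast
    qed
    ultimately have cases: "h ` T = S \<or> h ` T = carrier A"
      by (rule max)
    have vim: "x \<in> T" if x: "x \<in> carrier R" "h x \<in> h ` T" for x
    proof -
      obtain t where t: "t \<in> T" "h x = h t"
        using x(2) by blast
      have tc: "t \<in> carrier R"
        using t TE(1) by blast
      have "h (x \<ominus>\<^bsub>R\<^esub> t) = \<zero>\<^bsub>A\<^esub>"
        using x(1) tc t(2) by (simp add: R.minus_eq S.r_neg)
      then have "x \<ominus>\<^bsub>R\<^esub> t \<in> T"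
        using T(2) x(1) tc subringE(2)[OF S(1)] unfolding S'_def by auto
      then have "(x \<ominus>\<^bsub>R\<^esub> t) \<oplus>\<^bsub>R\<^esub> t \<in> T"
        using t(1) TE(7) by blast
      moreover have "(x \<ominus>\<^bsub>R\<^esub> t) \<oplus>\<^bsub>R\<^esub> t = x"
        using x(1) tc by (simp add: R.minus_eq R.a_assoc R.l_neg)
      ultimately show ?thesis
        by simp
    qed
    from cases show ?thesis
    proof (elim disjE)
      assume "h ` T = S"
      then have "T \<subseteq> S'"
        using TE(1) unfolding S'_def by blast
      then show ?thesis
        using T(2) by simp
    next
      assume "h ` T = carrier A"
      then have "carrier R \<subseteq> T"
        using vim by (intro subsetI) simp
      then show ?thesis
        using TE(1) by simp
    qed
  qed
  ultimately show ?thesis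
    unfolding submaximal_def maximal_subring_def by blast
qed

section \<open>The Frobenius map\<close>

context cring
begin

lemma add_pow_zero_if_dvd:
  assumes "[(p::nat)] \<cdot> \<one> = \<zero>" "p dvd c" "a \<in> carrier R"
  shows "[c] \<cdot> a = \<zero>"
proof -
  obtain d where d: "c = p * d"
    using assms(2) by blast
  have "[p] \<cdot> a = \<zero>"
    using assms(1,3) add_pow_ldistr[of \<one> a p] by simp
  then have "[d] \<cdot> ([p] \<cdot> a) = \<zero>"
    using add.nat_pow_one by simp
  then show ?thesis
    using assms(3) add.nat_pow_pow[of a d p] by (simp add: d mult.commute)
qed

lemma binomial_expansion:
  assumes "x \<in> carrier R" "y \<in> carrier R"
  shows "(x \<oplus> y) [^] (n::nat) = (\<Oplus>i\<in>{..n}. [(n choose i)] \<cdot> (x [^] i \<otimes> y [^] (n - i)))"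
proof (induction n)
  case 0
  show ?case by simp
next
  case (Suc n)
  let ?f = "\<lambda>i. [(n choose i)] \<cdot> (x [^] i \<otimes> y [^] (n - i))"
  have "(x \<oplus> y) [^] Suc n = (\<Oplus>i\<in>{..n}. ?f i) \<otimes> (x \<oplus> y)"
    using Suc.IH by simp
  also have "\<dots> = (\<Oplus>i\<in>{..n}. ?f i) \<otimes> x \<oplus> (\<Oplus>i\<in>{..n}. ?f i) \<otimes> y"
    using assms by (intro r_distr finsum_closed) auto
  also have "(\<Oplus>i\<in>{..n}. ?f i) \<otimes> x = (\<Oplus>i\<in>{..n}. [(n choose i)] \<cdot> (x [^] Suc i \<otimes> y [^] (Suc n - Suc i)))"
  proof -
    have "(\<Oplus>i\<in>{..n}. ?f i) \<otimes> x = (\<Oplus>i\<in>{..n}. ?f i \<otimes> x)"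
      using assms by (intro finsum_ldistr) auto
    also have "\<dots> = (\<Oplus>i\<in>{..n}. [(n choose i)] \<cdot> (x [^] Suc i \<otimes> y [^] (Suc n - Suc i)))"
      using assms by (intro finsum_cong') (auto simp: m_ac simp flip: add_pow_rdistr)
    finally show ?thesis .
  qed
  \<comment> \<open>Padding this sum with a zero term at i = 0, and the other one with the vanishing
    term at i = Suc n, gives both the same index set, so that Pascal's rule applies term by
    term.\<close>
  also have "\<dots> = (\<Oplus>i\<in>{..Suc n}. (case i of 0 \<Rightarrow> \<zero> | Suc j \<Rightarrow> [(n choose j)] \<cdot> (x [^] i \<otimes> y [^] (Suc n - i))))"
    using assms by (subst finsum_Suc2) (auto split: nat.split)
  also have "(\<Oplus>i\<in>{..n}. ?f i) \<otimes> y = (\<Oplus>i\<in>{..Suc n}. [(n choose i)] \<cdot> (x [^] i \<otimes> y [^] (Suc n - i)))"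
  proof -
    have "(\<Oplus>i\<in>{..n}. ?f i) \<otimes> y = (\<Oplus>i\<in>{..n}. ?f i \<otimes> y)"
      using assms by (intro finsum_ldistr) auto
    also have "\<dots> = (\<Oplus>i\<in>{..n}. [(n choose i)] \<cdot> (x [^] i \<otimes> y [^] (Suc n - i)))"
      using assms by (intro finsum_cong') (auto simp: add_pow_ldistr m_assoc Suc_diff_le)
    also have "\<dots> = (\<Oplus>i\<in>{..Suc n}. [(n choose i)] \<cdot> (x [^] i \<otimes> y [^] (Suc n - i)))"
      using assms by (subst finsum_Suc) (auto simp: binomial_eq_0)
    finally show ?thesis .
  qed
  also have "(\<Oplus>i\<in>{..Suc n}. (case i of 0 \<Rightarrow> \<zero> | Suc j \<Rightarrow> [(n choose j)] \<cdot> (x [^] i \<otimes> y [^] (Suc n - i))))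
      \<oplus> (\<Oplus>i\<in>{..Suc n}. [(n choose i)] \<cdot> (x [^] i \<otimes> y [^] (Suc n - i)))
      = (\<Oplus>i\<in>{..Suc n}. (case i of 0 \<Rightarrow> \<zero> | Suc j \<Rightarrow> [(n choose j)] \<cdot> (x [^] i \<otimes> y [^] (Suc n - i)))
          \<oplus> [(n choose i)] \<cdot> (x [^] i \<otimes> y [^] (Suc n - i)))"
    using assms by (intro finsum_addf[symmetric]) (auto split: nat.split)
  also have "\<dots> = (\<Oplus>i\<in>{..Suc n}. [(Suc n choose i)] \<cdot> (x [^] i \<otimes> y [^] (Suc n - i)))"
    using assms by (intro finsum_cong') (auto split: nat.split simp: add.nat_pow_mult)
  finally show ?case .
qed

lemma frobenius_add:
  assumes p: "normalization_semidom_class.prime (p::nat)" "[p] \<cdot> \<one> = \<zero>" and xy: "x \<in> carrier R" "y \<in> carrier R"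
  shows "(x \<oplus> y) [^] p = x [^] p \<oplus> y [^] p"
proof -
  let ?f = "\<lambda>i. [(p choose i)] \<cdot> (x [^] i \<otimes> y [^] (p - i))"
  have p0: "p > 0"
    using p(1) prime_gt_0_nat by blast
  have f: "?f \<in> {..p} \<rightarrow> carrier R"
    using xy by auto
  have "(\<Oplus>i\<in>{..p}. ?f i) = (\<Oplus>i\<in>{0,p}. ?f i)"
  proof (rule add.finprod_mono_neutral_cong_right)
    show "?f i = \<zero>" if i: "i \<in> {..p} - {0, p}" for i
    proof -
      from i have "p dvd (p choose i)"
        using p(1) by (intro dvd_choose_prime) auto
      then show "?f i = \<zero>"
        using add_pow_zero_if_dvd[OF p(2)] xy by simp
    qed
  qed (use f in auto)
  also have "\<dots> = y [^] p \<oplus> x [^] p"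
    using p0 xy by (subst finsum_insert) (auto simp: l_one)
  finally show ?thesis
    using binomial_expansion[OF xy, of p] xy by (simp add: a_comm)
qed

lemma frobenius_pow_add:
  assumes p: "normalization_semidom_class.prime (p::nat)" "[p] \<cdot> \<one> = \<zero>" and xy: "x \<in> carrier R" "y \<in> carrier R"
  shows "(x \<oplus> y) [^] (p ^ m) = x [^] (p ^ m) \<oplus> y [^] (p ^ m)"
proof (induction m)
  case 0
  show ?case using xy by simp
next
  case (Suc m)
  have "(x \<oplus> y) [^] (p ^ Suc m) = ((x \<oplus> y) [^] (p ^ m)) [^] p"
    using xy by (simp add: nat_pow_pow mult.commute)
  also have "\<dots> = (x [^] (p ^ m)) [^] p \<oplus> (y [^] (p ^ m)) [^] p"
    using Suc xy frobenius_add[OF p] by simp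
  finally show ?case
    using xy by (simp add: nat_pow_pow mult.commute)
qed

text \<open>Additivity applied to x + (-x) = 0 gives the sign uniformly, without treating p = 2
  apart from odd p.\<close>

lemma frobenius_pow_uminus:
  assumes p: "normalization_semidom_class.prime (p::nat)" "[p] \<cdot> \<one> = \<zero>" and x: "x \<in> carrier R"
  shows "(\<ominus> x) [^] (p ^ m) = \<ominus> (x [^] (p ^ m))"
proof -
  have "p ^ m > 0"
    using p(1) prime_gt_0_nat by simp
  then have "\<zero> = (x \<oplus> \<ominus> x) [^] (p ^ m)"
    using x by (simp add: r_neg nat_pow_zero)
  also have "\<dots> = x [^] (p ^ m) \<oplus> (\<ominus> x) [^] (p ^ m)"
    using frobenius_pow_add[OF p] x by simp
  finally show ?thesis
    using x minus_equality[of "(\<ominus> x) [^] (p ^ m)" "x [^] (p ^ m)"] by (simp add: a_comm)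
qed

text \<open>Elements fixed by different powers of Frobenius are hereby fixed by a common one, with
  the product of the two exponents; this makes the fixed elements a ring.\<close>

lemma iterate_pow_fixed:
  assumes "x \<in> carrier R" "x [^] (p ^ m) = x"
  shows "x [^] ((p::nat) ^ (m * k)) = x"
proof (induction k)
  case (Suc k)
  have "x [^] (p ^ (m * Suc k)) = (x [^] (p ^ (m * k))) [^] (p ^ m)"
    using assms(1) by (simp add: nat_pow_pow power_add mult.commute)
  then show ?case
    using Suc assms(2) by simp
qed (use assms in simp)

end

section \<open>Valuation rings as maximal subrings of fields\<close>

lemma subring_mem_carrier: "subring S R \<Longrightarrow> a \<in> S \<Longrightarrow> a \<in> carrier R"
  using subringE(1)[of S R] by blast

context cring
begin

text \<open>\<open>poly_upto S x n\<close> is the \<open>S\<close>-module spanned by \<open>1, x, \<dots>, x\<^sup>n\<close>.\<close>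

fun poly_upto :: "'a set \<Rightarrow> 'a \<Rightarrow> nat \<Rightarrow> 'a set" where
  "poly_upto S x 0 = S"
| "poly_upto S x (Suc n) = {a \<oplus> x \<otimes> b | a b. a \<in> S \<and> b \<in> poly_upto S x n}"

context
  fixes S x
  assumes S: "subring S R" and x: "x \<in> carrier R"
begin

lemma poly_upto_SucI:
  assumes "a \<in> S" "b \<in> poly_upto S x n"
  shows "a \<oplus> x \<otimes> b \<in> poly_upto S x (Suc n)"
  using assms by auto

lemma poly_upto_carrier: "b \<in> poly_upto S x n \<Longrightarrow> b \<in> carrier R"
  by (induction n arbitrary: b) (use subring_mem_carrier[OF S] x in auto)

lemma poly_upto_add:
  "\<lbrakk>b \<in> poly_upto S x n; c \<in> poly_upto S x n\<rbrakk> \<Longrightarrow> b \<oplus> c \<in> poly_upto S x n"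
proof (induction n arbitrary: b c)
  case 0
  then show ?case using subringE(7)[OF S] by simp
next
  case (Suc n)
  obtain a b' where b: "b = a \<oplus> x \<otimes> b'" "a \<in> S" "b' \<in> poly_upto S x n"
    using Suc.prems(1) by auto
  obtain a2 c' where c: "c = a2 \<oplus> x \<otimes> c'" "a2 \<in> S" "c' \<in> poly_upto S x n"
    using Suc.prems(2) by auto
  have "b \<oplus> c = (a \<oplus> a2) \<oplus> x \<otimes> (b' \<oplus> c')"
    using b c subring_mem_carrier[OF S] poly_upto_carrier x by (simp add: r_distr a_ac)
  then show ?case
    using poly_upto_SucI[of "a \<oplus> a2" "b' \<oplus> c'" n] subringE(7)[OF S] Suc.IH b c by metis
qed

lemma poly_upto_smult:
  "\<lbrakk>s \<in> S; b \<in> poly_upto S x n\<rbrakk> \<Longrightarrow> s \<otimes> b \<in> poly_upto S x n"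
proof (induction n arbitrary: b)
  case 0
  then show ?case using subringE(6)[OF S] by simp
next
  case (Suc n)
  obtain a b' where b: "b = a \<oplus> x \<otimes> b'" "a \<in> S" "b' \<in> poly_upto S x n"
    using Suc.prems(2) by auto
  have "s \<otimes> b = s \<otimes> a \<oplus> x \<otimes> (s \<otimes> b')"
    using b subring_mem_carrier[OF S] Suc.prems(1) poly_upto_carrier x by (simp add: r_distr m_ac)
  then show ?case
    using poly_upto_SucI[of "s \<otimes> a" "s \<otimes> b'" n] subringE(6)[OF S] Suc.IH Suc.prems(1) b by metis
qed

lemma poly_upto_0: "\<zero> \<in> poly_upto S x n"
proof (induction n)
  case (Suc n)
  then show ?case
    using poly_upto_SucI[OF subringE(2)[OF S] Suc] x by simp
qed (use subringE(2)[OF S] in simp)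

lemma poly_upto_incl: "a \<in> S \<Longrightarrow> a \<in> poly_upto S x n"
proof (cases n)
  case (Suc m)
  assume "a \<in> S"
  then show ?thesis
    using poly_upto_SucI[OF _ poly_upto_0, of a m] subring_mem_carrier[OF S] x Suc by simp
qed simp

lemma poly_upto_Suc: "b \<in> poly_upto S x n \<Longrightarrow> b \<in> poly_upto S x (Suc n)"
proof (induction n arbitrary: b)
  case 0
  then show ?case using poly_upto_incl[of b 1] by simp
next
  case (Suc n)
  then obtain a b' where b: "b = a \<oplus> x \<otimes> b'" "a \<in> S" "b' \<in> poly_upto S x n"
    by auto
  then show ?case
    using poly_upto_SucI[OF b(2) Suc.IH[OF b(3)]] by simp
qed

lemma poly_upto_times_x:
  assumes "b \<in> poly_upto S x n" shows "x \<otimes> b \<in> poly_upto S x (Suc n)"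
  using poly_upto_SucI[OF subringE(2)[OF S] assms] poly_upto_carrier[OF assms] x by simp

lemma poly_upto_pow: "x [^] n \<in> poly_upto S x n"
proof (induction n)
  case (Suc n)
  then show ?case
    using poly_upto_times_x[OF Suc] x by (simp add: m_comm)
qed (use subringE(3)[OF S] in simp)

lemma poly_upto_shift:
  "b \<in> poly_upto S x n \<Longrightarrow> x [^] j \<otimes> b \<in> poly_upto S x (n + j)"
proof (induction j)
  case (Suc j)
  have "x \<otimes> (x [^] j \<otimes> b) = x [^] Suc j \<otimes> b"
    using x poly_upto_carrier[OF Suc.prems] by (simp add: m_ac)
  then show ?case
    using poly_upto_times_x[OF Suc.IH[OF Suc.prems]] by simp
qed (use poly_upto_carrier in simp)

lemma poly_upto_top:
  "b \<in> poly_upto S x (Suc n) \<Longrightarrow> \<exists>c \<in> poly_upto S x n. \<exists>s\<in>S. b = c \<oplus> s \<otimes> x [^] Suc n"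
proof (induction n arbitrary: b)
  case 0
  then obtain a s where "b = a \<oplus> x \<otimes> s" "a \<in> S" "s \<in> S"
    by auto
  then have "b = a \<oplus> s \<otimes> x [^] Suc 0"
    using x subring_mem_carrier[OF S] by (simp add: m_comm)
  then show ?case
    using \<open>a \<in> S\<close> \<open>s \<in> S\<close> by auto
next
  case (Suc n)
  then obtain a b' where b: "b = a \<oplus> x \<otimes> b'" "a \<in> S" "b' \<in> poly_upto S x (Suc n)"
    by auto
  then obtain c s where c: "c \<in> poly_upto S x n" "s \<in> S" "b' = c \<oplus> s \<otimes> x [^] Suc n"
    using Suc.IH by blast
  have "b = (a \<oplus> x \<otimes> c) \<oplus> s \<otimes> x [^] Suc (Suc n)"
    using b c x subring_mem_carrier[OF S] poly_upto_carrier by (simp add: r_distr a_ac m_ac)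
  then show ?case
    using poly_upto_SucI[OF b(2) c(1)] c(2) by blast
qed

lemma simple_extension_poly_upto:
  assumes "b \<in> simple_extension S x"
  shows "\<exists>n. b \<in> poly_upto S x n"
  using assms
proof (induction rule: simple_extension.induct)
  case zero
  then show ?case using poly_upto_0 by blast
next
  case (lin b a)
  then obtain n where n: "b \<in> poly_upto S x n" by blast
  have "b \<otimes> x \<oplus> a = a \<oplus> x \<otimes> b"
    using x subring_mem_carrier[OF S] lin n poly_upto_carrier by (simp add: m_comm a_comm)
  then show ?case
    using poly_upto_SucI[OF lin(2) n] by metis
qed

end

text \<open>As y = 1/x, multiplication by x^n reverses the coefficients of a polynomial of degree at
  most n.\<close>

lemma poly_upto_reverse:
  assumes S: "subring S R" and xy: "x \<in> carrier R" "y \<in> carrier R" "x \<otimes> y = \<one>"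
  shows "b \<in> poly_upto S y n \<Longrightarrow> x [^] n \<otimes> b \<in> poly_upto S x n"
proof (induction n arbitrary: b)
  case 0
  then show ?case using subring_mem_carrier[OF S] by simp
next
  case (Suc n)
  then obtain a c where b: "b = a \<oplus> y \<otimes> c" "a \<in> S" "c \<in> poly_upto S y n"
    by auto
  have car: "a \<in> carrier R" "c \<in> carrier R"
    using b subring_mem_carrier[OF S] poly_upto_carrier[OF S xy(2)] by auto
  have "x [^] Suc n \<otimes> (y \<otimes> c) = (x [^] n \<otimes> c) \<otimes> (x \<otimes> y)"
    using xy(1,2) car by (simp add: m_ac)
  then have "x [^] Suc n \<otimes> b = a \<otimes> x [^] Suc n \<oplus> x [^] n \<otimes> c"
    using b car xy by (simp add: r_distr m_comm)
  then show ?case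
    using poly_upto_add[OF S xy(1)] poly_upto_smult[OF S xy(1) b(2) poly_upto_pow[OF S xy(1)]]
      poly_upto_Suc[OF S xy(1) Suc.IH[OF b(3)]] by metis
qed

text \<open>Elements of S[1/a] are fractions over powers of \<open>a\<close>: the reversed
  polynomial is one in \<open>a\<close>, and it already has its value in \<open>S\<close> because
  \<open>a\<close> does.\<close>

lemma clear_denominators:
  assumes S: "subring S R" and a: "a \<in> S" and b: "b \<in> carrier R" "a \<otimes> b = \<one>"
    and c: "c \<in> simple_extension S b"
  shows "\<exists>n::nat. a [^] n \<otimes> c \<in> S"
proof -
  note SE = subringE[OF S]
  have ac: "a \<in> carrier R"
    using a subring_mem_carrier[OF S] by blast
  obtain n where "c \<in> poly_upto S b n"
    using simple_extension_poly_upto[OF S b(1) c] by blast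
  then have "a [^] n \<otimes> c \<in> poly_upto S a n"
    using poly_upto_reverse[OF S ac b] by blast
  moreover have "poly_upto S a k \<subseteq> S" for k
    by (induction k) (use SE(6,7) a in auto)
  ultimately show ?thesis
    by blast
qed

end

section \<open>Chevalley's construction of valuation rings\<close>

context field
begin

lemma maximal_subring_avoiding_inverse:
  assumes D: "subring D R" "u \<in> D" "inv u \<notin> D"
  obtains S where "subring S R" "D \<subseteq> S" "inv u \<notin> S"
    "\<And>T. \<lbrakk>subring T R; S \<subset> T\<rbrakk> \<Longrightarrow> inv u \<in> T"
proof -
  define \<A> where "\<A> = {T. subring T R \<and> D \<subseteq> T \<and> inv u \<notin> T}"
  have "\<exists>M\<in>\<A>. \<forall>Y\<in>\<A>. M \<subseteq> Y \<longrightarrow> Y = M"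
  proof (rule subset_Zorn_nonempty)
    show "\<A> \<noteq> {}"
      using D unfolding \<A>_def by blast
    fix \<C> assume \<C>: "\<C> \<noteq> {}" "subset.chain \<A> \<C>"
    have sub: "\<C> \<subseteq> \<A>"
      using \<C>(2) unfolding subset.chain_def by blast
    have "subring (\<Union>\<C>) R"
      using subring_Union_chain[OF ring_axioms \<C>] sub unfolding \<A>_def by blast
    then show "\<Union>\<C> \<in> \<A>"
      using sub \<C>(1) unfolding \<A>_def by blast
  qed
  then obtain S where "S \<in> \<A>" and max: "\<forall>Y\<in>\<A>. S \<subseteq> Y \<longrightarrow> Y = S" by blast
  then have S: "subring S R" "D \<subseteq> S" "inv u \<notin> S"
    unfolding \<A>_def by simp_all
  have "inv u \<in> T" if "subring T R" "S \<subset> T" for T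
  proof (rule ccontr)
    assume "inv u \<notin> T"
    then have "T \<in> \<A>"
      using that S(2) unfolding \<A>_def by auto
    then show False
      using max that(2) by blast
  qed
  then show thesis
    using that[OF S] by blast
qed

text \<open>
  A subring that is maximal among those containing \<open>u\<close> but not its inverse is a valuation ring
  with \<open>u\<close> in its Jacobson radical.
\<close>

context
  fixes S u
  assumes S: "subring S R" and u: "u \<in> S" "u \<noteq> \<zero>" "inv u \<notin> S"
    and max: "\<And>T. \<lbrakk>subring T R; S \<subset> T\<rbrakk> \<Longrightarrow> inv u \<in> T"
begin

lemma u_carr: "u \<in> carrier R" "inv u \<in> carrier R" "u \<otimes> inv u = \<one>"
  using u subring_mem_carrier[OF S] field_Units by auto

text \<open>Put w = 1 + uv. If 1/w were missing from \<open>S\<close>, then S[1/w] would contain 1/u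
  by maximality, so w^n/u would lie in \<open>S\<close> for some n. But w^n is congruent to 1 modulo
  uS, so w^n/u differs from 1/u by an element of \<open>S\<close>, and 1/u would lie in
  \<open>S\<close>.\<close>

lemma one_plus_mult_unit:
  assumes "v \<in> S"
  shows "\<one> \<oplus> u \<otimes> v \<noteq> \<zero>" "inv (\<one> \<oplus> u \<otimes> v) \<in> S"
proof -
  note SE = subringE[OF S]
  have v: "v \<in> carrier R" using assms subring_mem_carrier[OF S] by blast
  show nz: "\<one> \<oplus> u \<otimes> v \<noteq> \<zero>"
  proof
    assume "\<one> \<oplus> u \<otimes> v = \<zero>"
    then have "u \<otimes> v = \<ominus> \<one>"
      using minus_equality[of "u \<otimes> v" \<one>] v u_carr by (simp add: a_comm)
    then have "u \<otimes> (\<ominus> v) = \<one>"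
      using v u_carr by (simp add: r_minus)
    then have "inv u = \<ominus> v"
      using v u_carr by (metis a_inv_closed comm_inv_char)
    then show False
      using u(3) SE(5)[OF assms] by simp
  qed
  define w where "w = \<one> \<oplus> u \<otimes> v"
  have w: "w \<in> S" "w \<in> carrier R" "w \<noteq> \<zero>"
    using nz SE(3,6,7) u(1) assms v u_carr unfolding w_def by simp_all
  have iw: "inv w \<in> carrier R" "w \<otimes> inv w = \<one>"
    using w(2,3) field_Units by auto
  show "inv (\<one> \<oplus> u \<otimes> v) \<in> S"
  proof (rule ccontr)
    assume "\<not> inv (\<one> \<oplus> u \<otimes> v) \<in> S"
    then have "S \<subset> simple_extension S (inv w)"
      using simple_extension_incl[OF SE(1) iw(1)] simple_extension_mem[OF S iw(1)] w_def by blast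
    then have "inv u \<in> simple_extension S (inv w)"
      using max[OF simple_extension_is_subring[OF S iw(1)]] by blast
    then obtain n :: nat where a: "w [^] n \<otimes> inv u \<in> S"
      using clear_denominators[OF S w(1) iw] by blast
    have "\<exists>z\<in>S. w [^] k = \<one> \<oplus> u \<otimes> z" for k :: nat
    proof (induction k)
      case 0
      show ?case using SE(2) u_carr by (intro bexI[of _ \<zero>]) auto
    next
      case (Suc k)
      then obtain z where z: "z \<in> S" "w [^] k = \<one> \<oplus> u \<otimes> z" by blast
      have zc: "z \<in> carrier R" using z subring_mem_carrier[OF S] by blast
      have "w [^] Suc k = \<one> \<oplus> u \<otimes> (v \<oplus> z \<oplus> u \<otimes> z \<otimes> v)"
        using z(2) zc v u_carr by (simp add: w_def l_distr r_distr m_ac a_ac)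
      moreover have "v \<oplus> z \<oplus> u \<otimes> z \<otimes> v \<in> S"
        using z(1) assms u(1) by (intro SE(6,7))
      ultimately show ?case by blast
    qed
    then obtain z where z: "z \<in> S" "w [^] n = \<one> \<oplus> u \<otimes> z" by blast
    have zc: "z \<in> carrier R" using z subring_mem_carrier[OF S] by blast
    have "w [^] n \<otimes> inv u = inv u \<oplus> (u \<otimes> inv u) \<otimes> z"
      using z zc u_carr(1,2) by (simp add: l_distr r_distr m_ac)
    then have "w [^] n \<otimes> inv u = inv u \<oplus> z"
      using zc u_carr by simp
    then have "inv u = w [^] n \<otimes> inv u \<oplus> \<ominus> z"
      using zc u_carr(2) by (simp add: a_assoc r_neg)
    then show False
      using a z(1) SE(5,7) u(3) by metis
  qed
qed

text \<open>Both polynomials represent 1/u. The one in \<open>y\<close> has constant term b, and 1 -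
  ub is a unit of \<open>S\<close>; dividing by it gives 1 = u y g'. Multiplication by x^n turns
  this into x^n = u h with h of degree below n in \<open>x\<close>, which is substituted for the
  leading power of \<open>p\<close>. The conclusion records \<open>n > 0\<close> so that passing to
  n - 1 is a real decrease.\<close>

lemma valuation_descent:
  assumes xy: "x \<in> carrier R" "y \<in> carrier R" "x \<otimes> y = \<one>"
    and P: "p \<in> poly_upto S x n" "u \<otimes> p = \<one>" and Q: "q \<in> poly_upto S y m" "u \<otimes> q = \<one>"
    and le: "m \<le> n"
  shows "\<exists>p'\<in>poly_upto S x (n - 1). u \<otimes> p' = \<one> \<and> n > 0 \<and> m > 0"
proof -
  note SE = subringE[OF S]
  have inv_u: "z = inv u" if "u \<otimes> z = \<one>" "z \<in> carrier R" for z
    using that u_carr by (metis comm_inv_char)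
  have m0: "m > 0"
  proof (rule ccontr)
    assume "\<not> m > 0"
    then show False using Q inv_u u(3) subring_mem_carrier[OF S] by auto
  qed
  then obtain m' where m': "m = Suc m'" by (cases m) auto
  obtain n' where n': "n = Suc n'" using m0 le by (cases n) auto
  obtain b g where q: "q = b \<oplus> y \<otimes> g" "b \<in> S" "g \<in> poly_upto S y m'"
    using Q(1) m' by auto
  have car: "b \<in> carrier R" "g \<in> carrier R"
    using q subring_mem_carrier[OF S] poly_upto_carrier[OF S xy(2)] by auto
  define w where "w = \<one> \<oplus> u \<otimes> (\<ominus> b)"
  have w: "inv w \<in> S" "w \<noteq> \<zero>" "w \<in> carrier R"
    using one_plus_mult_unit[of "\<ominus> b"] SE(5)[OF q(2)] car u_carr unfolding w_def by auto
  have wi: "inv w \<otimes> w = \<one>" "inv w \<in> carrier R"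
    using w field_Units by auto
  have "u \<otimes> (y \<otimes> g) = w"
  proof -
    have "\<one> = u \<otimes> b \<oplus> u \<otimes> (y \<otimes> g)"
      using Q(2) q(1) car xy u_carr by (simp add: r_distr)
    then have "w = (u \<otimes> b \<oplus> u \<otimes> (y \<otimes> g)) \<oplus> \<ominus> (u \<otimes> b)"
      unfolding w_def using car u_carr by (simp add: r_minus)
    also have "\<dots> = u \<otimes> (y \<otimes> g)"
      using car xy u_carr(1) by (simp add: a_ac r_neg r_neg1 r_neg2)
    finally show ?thesis by simp
  qed
  define g' where "g' = inv w \<otimes> g"
  have g': "g' \<in> poly_upto S y m'" "g' \<in> carrier R"
    using poly_upto_smult[OF S xy(2) w(1) q(3)] wi car unfolding g'_def by auto
  have one: "\<one> = u \<otimes> (y \<otimes> g')"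
    using \<open>u \<otimes> (y \<otimes> g) = w\<close> wi car xy u_carr(1) unfolding g'_def by (metis m_closed m_lcomm)
  have h: "x [^] m' \<otimes> g' \<in> poly_upto S x m'"
    using poly_upto_reverse[OF S xy g'(1)] .
  \<comment> \<open>The factor x^m' converts g' into a polynomial in \<open>x\<close> of degree at
    most m', and the remaining n' - m' powers raise the bound to n'. Here m <= n is
    essential.\<close>
  define h where "h = x [^] (n' - m') \<otimes> (x [^] m' \<otimes> g')"
  have hn: "h \<in> poly_upto S x n'"
    using poly_upto_shift[OF S xy(1) h, of "n' - m'"] le m' n' unfolding h_def by simp
  have h_eq: "h = x [^] n' \<otimes> g'"
    unfolding h_def using xy g'(2) le m' n' by (simp add: m_assoc[symmetric] nat_pow_mult)
  have top: "x [^] Suc n' = u \<otimes> h"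
  proof -
    have "x [^] Suc n' = x [^] Suc n' \<otimes> (u \<otimes> (y \<otimes> g'))"
      using one xy by (metis nat_pow_closed r_one)
    also have "\<dots> = (x \<otimes> y) \<otimes> (u \<otimes> (x [^] n' \<otimes> g'))"
      using xy(1,2) g'(2) u_carr(1) by (simp add: m_ac)
    also have "\<dots> = u \<otimes> h"
      using xy u_carr(1) g'(2) h_eq by simp
    finally show ?thesis .
  qed
  obtain c s where p: "c \<in> poly_upto S x n'" "s \<in> S" "p = c \<oplus> s \<otimes> x [^] Suc n'"
    using poly_upto_top[OF S xy(1)] P(1) n' by blast
  have "c \<oplus> s \<otimes> (u \<otimes> h) \<in> poly_upto S x n'"
    using poly_upto_add[OF S xy(1) p(1)] poly_upto_smult[OF S xy(1) _ hn, of "s \<otimes> u"]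
      p(2) u(1) SE(6) m_assoc[of s u h] subring_mem_carrier[OF S] poly_upto_carrier[OF S xy(1) hn] by metis
  then show ?thesis
    using P(2) p(3) top m0 n' by auto
qed

text \<open>If both elements were missing, S[x] and S[y] would both contain 1/u. The polynomial of
  larger degree bound can then always be shortened, with \<open>x\<close> and \<open>y\<close>
  exchanging roles as needed, which is infinite descent on the sum of the two bounds.\<close>

lemma valuation_ring:
  assumes xy: "x \<in> carrier R" "y \<in> carrier R" "x \<otimes> y = \<one>"
  shows "x \<in> S \<or> y \<in> S"
proof (rule ccontr)
  note SE = subringE[OF S]
  assume neg: "\<not> (x \<in> S \<or> y \<in> S)"
  have ex: "\<exists>n. \<exists>p\<in>poly_upto S z n. u \<otimes> p = \<one>" if "z \<in> carrier R" "z \<notin> S" for z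
  proof -
    have "S \<subset> simple_extension S z"
      using simple_extension_incl[OF SE(1) that(1)] simple_extension_mem[OF S that(1)] that by blast
    then have "inv u \<in> simple_extension S z"
      using max[OF simple_extension_is_subring[OF S that(1)]] by blast
    then show ?thesis
      using simple_extension_poly_upto[OF S that(1)] u_carr(3) by blast
  qed
  have no: "\<lbrakk>p \<in> poly_upto S x n; u \<otimes> p = \<one>; q \<in> poly_upto S y m; u \<otimes> q = \<one>\<rbrakk> \<Longrightarrow> False"
    for p q m n
  proof (induction "n + m" arbitrary: p q n m rule: less_induct)
    case less
    show ?case
    proof (cases "m \<le> n")
      case True
      then show False
        using valuation_descent[OF xy less.prems] less.hyps[of "n - 1" m] less.prems by fastforce
    next
      case False
      have "y \<otimes> x = \<one>" using xy by (simp add: m_comm)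
      then show False
        using valuation_descent[OF xy(2,1) _ less.prems(3,4,1,2)] False
          less.hyps[of n "m - 1"] less.prems by fastforce
    qed
  qed
  show False
    using ex[OF xy(1)] ex[OF xy(2)] neg no by blast
qed

end

end

lemma (in ring) eq_if_diff_zero:
  assumes "a \<in> carrier R" "b \<in> carrier R" "a \<oplus> \<ominus> b = \<zero>"
  shows "a = b"
  using minus_equality[of a "\<ominus> b"] assms by simp

context cring
begin

lemma subring_pow_closed:
  assumes "subring S R" "a \<in> S"
  shows "a [^] (n::nat) \<in> S"
  by (induction n) (use subringE(3,6)[OF assms(1)] assms(2) in auto)

lemma prime_subring_int:
  "[(i + j :: int)] \<cdot> \<one> = [i] \<cdot> \<one> \<oplus> [j] \<cdot> \<one>"
  "[(- i :: int)] \<cdot> \<one> = \<ominus> ([i] \<cdot> \<one>)"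
  "[(i * j :: int)] \<cdot> \<one> = [i] \<cdot> \<one> \<otimes> [j] \<cdot> \<one>"
proof -
  show "[(i + j :: int)] \<cdot> \<one> = [i] \<cdot> \<one> \<oplus> [j] \<cdot> \<one>"
    by (rule add.int_pow_mult) simp
  show "[(- i :: int)] \<cdot> \<one> = \<ominus> ([i] \<cdot> \<one>)"
    using add.int_pow_neg[of \<one> i] by simp
  have "[i] \<cdot> \<one> \<otimes> [j] \<cdot> \<one> = [i] \<cdot> (\<one> \<otimes> [j] \<cdot> \<one>)"
    by (rule add_pow_ldistr_int) auto
  also have "\<dots> = [(i * j)] \<cdot> \<one>"
    using add.int_pow_pow[of \<one> i j] by (simp add: mult.commute)
  finally show "[(i * j :: int)] \<cdot> \<one> = [i] \<cdot> \<one> \<otimes> [j] \<cdot> \<one>" ..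
qed

lemma prime_subring_subring: "subring (prime_subring R) R"
proof (rule subringI)
  show "prime_subring R \<subseteq> carrier R"
    unfolding prime_subring_def by auto
  have "\<one> = [(1::int)] \<cdot> \<one>"
    by simp
  then show "\<one> \<in> prime_subring R"
    unfolding prime_subring_def by blast
  show "\<ominus> a \<in> prime_subring R" if "a \<in> prime_subring R" for a
    using that unfolding prime_subring_def by (auto simp flip: prime_subring_int(2))
  show "a \<otimes> b \<in> prime_subring R" if "a \<in> prime_subring R" "b \<in> prime_subring R" for a b
    using that unfolding prime_subring_def by (auto simp flip: prime_subring_int(3))
  show "a \<oplus> b \<in> prime_subring R" if "a \<in> prime_subring R" "b \<in> prime_subring R" for a b
    using that unfolding prime_subring_def by (auto simp flip: prime_subring_int(1))
qed

end

lemma (in domain) simple_extension_swap: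
  assumes K: "subring K R" and xy: "x \<in> carrier R" "y \<in> carrier R"
  shows "simple_extension (simple_extension K x) y \<subseteq> simple_extension (simple_extension K y) x"
proof (rule simple_extension_subring_incl)
  have Ky: "subring (simple_extension K y) R"
    using simple_extension_is_subring[OF K xy(2)] .
  show "subring (simple_extension (simple_extension K y) x) R"
    using simple_extension_is_subring[OF Ky xy(1)] .
  show "simple_extension K x \<subseteq> simple_extension (simple_extension K y) x"
    by (rule mono_simple_extension)
      (use simple_extension_incl subringE(1)[OF K] xy in blast)
  have "simple_extension K y \<subseteq> simple_extension (simple_extension K y) x"
    by (rule simple_extension_incl[OF subringE(1)[OF Ky] xy(1)])
  then show "y \<in> simple_extension (simple_extension K y) x"
    using simple_extension_mem[OF K xy(2)] by blast
qed

section \<open>From valuation rings to maximal subrings: the transcendental case\<close>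

context field
begin

lemma inverse_unique:
  assumes "x \<in> carrier R" "y \<in> carrier R" "x \<otimes> y = \<one>"
  shows "y = inv x"
  using assms comm_inv_char by metis

lemma inv_props:
  assumes "x \<in> carrier R" "x \<noteq> \<zero>"
  shows "inv x \<in> carrier R" "x \<otimes> inv x = \<one>" "inv x \<noteq> \<zero>"
proof -
  show c: "inv x \<in> carrier R" "x \<otimes> inv x = \<one>"
    using assms field_Units by auto
  show "inv x \<noteq> \<zero>"
    using c assms(1) by auto
qed

text \<open>Take \<open>S\<close> maximal among the subrings containing \<open>D\<close> but not
  1/u. Every strictly larger subring contains 1/u, hence contains S[1/u], so \<open>S\<close> is a
  maximal subring as soon as S[1/u] is the whole field. The premises available in
  \<open>full\<close> are what S[1/u] inherits from \<open>S\<close>: the valuation property and the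
  units 1 + uv.\<close>

lemma submaximal_if_all_overrings_full:
  assumes D: "subring D R" "u \<in> D" "u \<noteq> \<zero>" "inv u \<notin> D"
    and full: "\<And>T. \<lbrakk>subring T R; D \<subseteq> T; inv u \<in> T;
        \<And>x. \<lbrakk>x \<in> carrier R; x \<noteq> \<zero>\<rbrakk> \<Longrightarrow> x \<in> T \<or> inv x \<in> T;
        \<And>v. v \<in> D \<Longrightarrow> \<exists>e\<in>T. (\<one> \<oplus> u \<otimes> v) \<otimes> e = \<one>\<rbrakk> \<Longrightarrow> carrier R \<subseteq> T"
  shows "submaximal R"
proof -
  obtain S where S: "subring S R" "D \<subseteq> S" "inv u \<notin> S"
    and max: "\<And>T. \<lbrakk>subring T R; S \<subset> T\<rbrakk> \<Longrightarrow> inv u \<in> T"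
    using maximal_subring_avoiding_inverse[OF D(1,2,4)] by metis
  have uS: "u \<in> S"
    using D(2) S(2) by blast
  have uc: "u \<in> carrier R" "inv u \<in> carrier R" "u \<otimes> inv u = \<one>"
    using uS subring_mem_carrier[OF S(1)] inv_props[OF _ D(3)] by auto
  define T where "T = simple_extension S (inv u)"
  have T: "subring T R" "S \<subseteq> T" "inv u \<in> T"
    unfolding T_def using simple_extension_is_subring[OF S(1) uc(2)]
      simple_extension_incl[OF subringE(1)[OF S(1)] uc(2)] simple_extension_mem[OF S(1) uc(2)]
    by auto
  have "carrier R \<subseteq> T"
  proof (rule full)
    show "x \<in> T \<or> inv x \<in> T" if "x \<in> carrier R" "x \<noteq> \<zero>" for x
      using valuation_ring[OF S(1) uS D(3) S(3) max that(1) inv_props(1,2)[OF that]] T(2) by blast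
    show "\<exists>e\<in>T. (\<one> \<oplus> u \<otimes> v) \<otimes> e = \<one>" if "v \<in> D" for v
    proof -
      have v: "v \<in> S" "v \<in> carrier R"
        using that S(2) subring_mem_carrier[OF D(1)] by auto
      note unit = one_plus_mult_unit[OF S(1) uS D(3) S(3) max v(1)]
      have "(\<one> \<oplus> u \<otimes> v) \<otimes> inv (\<one> \<oplus> u \<otimes> v) = \<one>"
        using unit(1) v uc(1) by (intro inv_props(2)) auto
      then show ?thesis
        using unit(2) T(2) by blast
    qed
  qed (use T S(2) in auto)
  moreover have "T \<subseteq> T'" if "subring T' R" "S \<subset> T'" for T'
    unfolding T_def using simple_extension_subring_incl[OF that(1)] that(2) max[OF that] by blast
  ultimately have "T' = carrier R" if "subring T' R" "S \<subset> T'" for T'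
    using that subringE(1)[OF that(1)] by blast
  then show ?thesis
    unfolding submaximal_def maximal_subring_def using S(1,3) uc(2) by blast
qed

text \<open>
  For nonzero \<open>u\<close> in a field the following says that \<open>u\<close> is transcendental over \<open>F\<close>: a
  polynomial relation of \<open>u\<close> over \<open>F\<close> with minimal degree has nonzero constant term.
\<close>

definition free_over :: "'a set \<Rightarrow> 'a \<Rightarrow> bool" where
  "free_over F u \<longleftrightarrow> (\<forall>w\<in>simple_extension F u. u \<otimes> w \<in> F \<longrightarrow> u \<otimes> w = \<zero>)"

lemma simple_extension_Union_chain:
  assumes "subset.chain \<A> \<C>" "\<C> \<noteq> {}" and "w \<in> simple_extension (\<Union>\<C>) u"
  shows "\<exists>F\<in>\<C>. w \<in> simple_extension F u"
  using assms(3)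
proof (induction rule: simple_extension.induct)
  case zero
  then show ?case using assms(2) by blast
next
  case (lin w a)
  then obtain F G where FG: "F \<in> \<C>" "w \<in> simple_extension F u" "G \<in> \<C>" "a \<in> G"
    by blast
  then have "F \<subseteq> G \<or> G \<subseteq> F"
    using assms(1) unfolding subset.chain_def by blast
  then show ?case
  proof
    assume "F \<subseteq> G"
    then have "w \<in> simple_extension G u"
      using FG(2) mono_simple_extension by blast
    then show ?thesis
      using simple_extension.lin FG(3,4) by blast
  next
    assume "G \<subseteq> F"
    then show ?thesis
      using simple_extension.lin[OF FG(2)] FG(1,4) by blast
  qed
qed

text \<open>Freeness passes to unions of chains, since a relation involves only finitely many
  coefficients and these lie in one member of the chain. Maximality will later show that this
  subring is closed under inverses, that is, a field.\<close>

lemma maximal_subring_free_over: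
  assumes F: "subring F R" "free_over F u"
  obtains M where "subring M R" "F \<subseteq> M" "free_over M u"
    "\<And>T. \<lbrakk>subring T R; M \<subseteq> T; free_over T u\<rbrakk> \<Longrightarrow> T = M"
proof -
  define \<A> where "\<A> = {T. subring T R \<and> F \<subseteq> T \<and> free_over T u}"
  have "\<exists>M\<in>\<A>. \<forall>Y\<in>\<A>. M \<subseteq> Y \<longrightarrow> Y = M"
  proof (rule subset_Zorn_nonempty)
    show "\<A> \<noteq> {}"
      using F unfolding \<A>_def by blast
    fix \<C> assume \<C>: "\<C> \<noteq> {}" "subset.chain \<A> \<C>"
    have sub: "\<C> \<subseteq> \<A>"
      using \<C>(2) unfolding subset.chain_def by blast
    have "subring (\<Union>\<C>) R"
      using subring_Union_chain[OF ring_axioms \<C>] sub unfolding \<A>_def by blast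
    moreover have "F \<subseteq> \<Union>\<C>"
      using sub \<C>(1) unfolding \<A>_def by blast
    moreover have "free_over (\<Union>\<C>) u"
      unfolding free_over_def
    proof (intro ballI impI)
      fix w assume w: "w \<in> simple_extension (\<Union>\<C>) u" "u \<otimes> w \<in> \<Union>\<C>"
      obtain F' where F': "F' \<in> \<C>" "w \<in> simple_extension F' u"
        using simple_extension_Union_chain[OF \<C>(2,1) w(1)] by blast
      obtain G where G: "G \<in> \<C>" "u \<otimes> w \<in> G"
        using w(2) by blast
      have "F' \<subseteq> G \<or> G \<subseteq> F'"
        using F'(1) G(1) \<C>(2) unfolding subset.chain_def by blast
      moreover have "free_over F' u" "free_over G u"
        using sub F'(1) G(1) unfolding \<A>_def by auto
      moreover have "w \<in> simple_extension G u" if "F' \<subseteq> G"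
        using mono_simple_extension[OF that] F'(2) by blast
      ultimately show "u \<otimes> w = \<zero>"
        using F'(2) G(2) unfolding free_over_def by blast
    qed
    ultimately show "\<Union>\<C> \<in> \<A>"
      unfolding \<A>_def by blast
  qed
  then obtain M where "M \<in> \<A>" and max: "\<forall>Y\<in>\<A>. M \<subseteq> Y \<longrightarrow> Y = M" by blast
  then have M: "subring M R" "F \<subseteq> M" "free_over M u"
    unfolding \<A>_def by simp_all
  have "T = M" if "subring T R" "M \<subseteq> T" "free_over T u" for T
  proof -
    have "T \<in> \<A>"
      using that M(2) unfolding \<A>_def by simp
    then show ?thesis
      using max that(2) by blast
  qed
  then show thesis
    using that[OF M] by blast
qed

text \<open>A relation over F[1/a] becomes one over \<open>F\<close> after multiplication by powers
  of \<open>a\<close>. Two exponents occur, one for the polynomial \<open>w\<close> and one for the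
  value u w, so the relation is multiplied by both powers.\<close>

lemma free_over_adjoin_inverse:
  assumes F: "subring F R" "free_over F u" and u: "u \<in> carrier R"
    and a: "a \<in> F" "a \<noteq> \<zero>"
  shows "free_over (simple_extension F (inv a)) u"
  unfolding free_over_def
proof (intro ballI impI)
  let ?b = "inv a"
  have ac: "a \<in> carrier R"
    using a(1) subring_mem_carrier[OF F(1)] by blast
  note b = inv_props[OF ac a(2)]
  have Fu: "subring (simple_extension F u) R"
    using simple_extension_is_subring[OF F(1) u] .
  have aFu: "a \<in> simple_extension F u"
    using a(1) simple_extension_incl[OF subringE(1)[OF F(1)] u] by blast
  fix w assume w: "w \<in> simple_extension (simple_extension F ?b) u"
    "u \<otimes> w \<in> simple_extension F ?b"
  have wb: "w \<in> simple_extension (simple_extension F u) ?b"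
    using w(1) simple_extension_swap[OF F(1) b(1) u] by blast
  obtain m :: nat where m: "a [^] m \<otimes> w \<in> simple_extension F u"
    using clear_denominators[OF Fu aFu b(1,2) wb] by blast
  obtain n :: nat where n: "a [^] n \<otimes> (u \<otimes> w) \<in> F"
    using clear_denominators[OF F(1) a(1) b(1,2) w(2)] by blast
  have wc: "w \<in> carrier R"
    using wb simple_extension_in_carrier[OF subringE(1)[OF Fu] b(1)] by blast
  let ?w = "a [^] n \<otimes> (a [^] m \<otimes> w)"
  have "?w \<in> simple_extension F u"
    using subringE(6)[OF Fu subring_pow_closed[OF Fu aFu] m] .
  moreover have eq: "u \<otimes> ?w = a [^] m \<otimes> (a [^] n \<otimes> (u \<otimes> w))"
    using u wc ac by (simp add: m_ac)
  moreover have "a [^] m \<otimes> (a [^] n \<otimes> (u \<otimes> w)) \<in> F"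
    using subringE(6)[OF F(1) subring_pow_closed[OF F(1) a(1)] n] .
  ultimately have "a [^] m \<otimes> (a [^] n \<otimes> (u \<otimes> w)) = \<zero>"
    using F(2) unfolding free_over_def by metis
  moreover have "a [^] k \<noteq> \<zero>" for k :: nat
    by (induction k) (use ac a(2) integral_iff in auto)
  ultimately show "u \<otimes> w = \<zero>"
    using u wc ac by (simp add: integral_iff)
qed

text \<open>The base ring is K[u] for a subfield \<open>K\<close> that is maximal with
  \<open>u\<close> transcendental over it. An overring \<open>T\<close> as in the criterion contains
  K(u). If \<open>T\<close> missed some x, then y = 1/x would be a non-unit of \<open>T\<close>, and
  reduction modulo \<open>y\<close> would show that \<open>u\<close> is still transcendental over
  K[y], against the maximality of \<open>K\<close>.\<close>

lemma submaximal_if_free: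
  assumes F: "subring F R" and u: "u \<in> carrier R" "u \<noteq> \<zero>" and free: "free_over F u"
  shows "submaximal R"
proof -
  obtain K where K: "subring K R" "free_over K u"
    and max: "\<And>T. \<lbrakk>subring T R; K \<subseteq> T; free_over T u\<rbrakk> \<Longrightarrow> T = K"
    using maximal_subring_free_over[OF F free] by metis
  note KE = subringE[OF K(1)]
  have in_K: "x \<in> K" if "x \<in> carrier R" "free_over (simple_extension K x) u" for x
    using max[OF simple_extension_is_subring[OF K(1) that(1)]
        simple_extension_incl[OF KE(1) that(1)] that(2)]
      simple_extension_mem[OF K(1) that(1)] by simp
  have K_inv: "inv a \<in> K" if "a \<in> K" "a \<noteq> \<zero>" for a
    using in_K[OF _ free_over_adjoin_inverse[OF K u(1) that]]
      inv_props(1)[OF _ that(2)] that(1) KE(1) by blast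
  define D where "D = simple_extension K u"
  have D: "subring D R" "u \<in> D" "K \<subseteq> D"
    unfolding D_def using simple_extension_is_subring[OF K(1) u(1)]
      simple_extension_mem[OF K(1) u(1)] simple_extension_incl[OF KE(1) u(1)] by auto
  note DE = subringE[OF D(1)]
  show ?thesis
  proof (rule submaximal_if_all_overrings_full)
    show "subring D R" "u \<in> D" "u \<noteq> \<zero>"
      using D u by auto
    show "inv u \<notin> D"
    proof
      assume "inv u \<in> D"
      then have "u \<otimes> inv u = \<zero>"
        using K(2) KE(3) inv_props(2)[OF u] unfolding free_over_def D_def by metis
      then show False
        using inv_props(2)[OF u] by simp
    qed
    fix T assume T: "subring T R" "D \<subseteq> T" "inv u \<in> T"
      and val: "\<And>x. \<lbrakk>x \<in> carrier R; x \<noteq> \<zero>\<rbrakk> \<Longrightarrow> x \<in> T \<or> inv x \<in> T"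
      and unit: "\<And>v. v \<in> D \<Longrightarrow> \<exists>e\<in>T. (\<one> \<oplus> u \<otimes> v) \<otimes> e = \<one>"
    note TE = subringE[OF T(1)]
    have KT: "K \<subseteq> T"
      using D(3) T(2) by blast
    \<comment> \<open>A polynomial in \<open>u\<close> with zero constant term loses a factor
      \<open>u\<close>, which is invertible in \<open>T\<close>. One with constant term a is a(1 + u
      v) with v in \<open>D\<close>, and both factors are invertible in \<open>T\<close>. Together
      these show that K(u) lies in \<open>T\<close>.\<close>
    have D_unit: "\<exists>e\<in>T. d \<otimes> e = \<one>" if "d \<in> D" "d \<noteq> \<zero>" for d
      using that unfolding D_def
    proof (induction rule: simple_extension.induct)
      case (lin d a)
      have dD: "d \<in> D" using lin unfolding D_def by simp
      have car: "d \<in> carrier R" "a \<in> carrier R"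
        using dD DE(1) lin(2) KE(1) by auto
      show ?case
      proof (cases "a = \<zero>")
        case True
        then have "d \<noteq> \<zero>" using lin.prems u by auto
        then obtain e where e: "e \<in> T" "d \<otimes> e = \<one>"
          using lin.IH by blast
        have ec: "e \<in> carrier R" using e TE(1) by blast
        have "(d \<otimes> u \<oplus> a) \<otimes> (e \<otimes> inv u) = (d \<otimes> e) \<otimes> (u \<otimes> inv u)"
          using True car ec u inv_props(1)[OF u] by (simp add: m_ac)
        also have "\<dots> = \<one>"
          using e inv_props(2)[OF u] by simp
        finally show ?thesis
          using TE(6)[OF e(1) T(3)] by blast
      next
        case False
        note ia = inv_props[OF car(2) False]
        have iaK: "inv a \<in> K" using K_inv lin(2) False by blast
        have "d \<otimes> inv a \<in> D"
          using dD iaK D(3) DE(6) by blast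
        then obtain e where e: "e \<in> T" "(\<one> \<oplus> u \<otimes> (d \<otimes> inv a)) \<otimes> e = \<one>"
          using unit by blast
        have ec: "e \<in> carrier R" using e TE(1) by blast
        have "a \<otimes> (\<one> \<oplus> u \<otimes> (d \<otimes> inv a)) = a \<oplus> (a \<otimes> inv a) \<otimes> (d \<otimes> u)"
          using car ia(1) u by (simp add: r_distr m_ac)
        then have "d \<otimes> u \<oplus> a = a \<otimes> (\<one> \<oplus> u \<otimes> (d \<otimes> inv a))"
          using car ia u by (simp add: a_comm)
        then have "(d \<otimes> u \<oplus> a) \<otimes> (inv a \<otimes> e)
            = (a \<otimes> inv a) \<otimes> ((\<one> \<oplus> u \<otimes> (d \<otimes> inv a)) \<otimes> e)"
          using car ia(1) u(1) ec by (simp add: m_ac)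
        also have "\<dots> = \<one>"
          using e(2) ia by simp
        finally show ?thesis
          using TE(6)[of "inv a" e] e(1) iaK KT by blast
      qed
    qed simp
    show "carrier R \<subseteq> T"
    proof (rule subsetI, rule ccontr)
      fix x assume x: "x \<in> carrier R" "x \<notin> T"
      have x0: "x \<noteq> \<zero>" using x(2) TE(2) by blast
      define y where "y = inv x"
      note y = inv_props[OF x(1) x0, folded y_def]
      have yT: "y \<in> T"
        using val[OF x(1) x0] x(2) y_def by blast
      have KyT: "simple_extension K y \<subseteq> T"
        using simple_extension_subring_incl[OF T(1) KT yT] .
      have DyT: "simple_extension D y \<subseteq> T"
        using simple_extension_subring_incl[OF T(1,2) yT] .
      have no_unit: "y \<otimes> z \<noteq> \<one>" if "z \<in> T" for z
      proof
        assume "y \<otimes> z = \<one>"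
        then have "z = inv y"
          using inverse_unique[OF y(1)] that TE(1) by blast
        moreover have "x = inv y"
          using inverse_unique[OF y(1) x(1)] y(2) x(1) y(1) by (simp add: m_comm)
        ultimately show False
          using x(2) that by simp
      qed
      text \<open>Modulo \<open>y\<close>, a non-unit of \<open>T\<close>, relations over \<open>K[y]\<close> become relations over \<open>K\<close>.\<close>
      have key: "\<forall>w\<in>simple_extension D y. c = u \<otimes> w \<longrightarrow> c = \<zero>"
        if "c \<in> simple_extension K y" for c
        using that
      proof (induction rule: simple_extension.induct)
        case (lin c a)
        show ?case
        proof (intro ballI impI)
          fix w assume w: "w \<in> simple_extension D y" "c \<otimes> y \<oplus> a = u \<otimes> w"
          have cT: "c \<in> T" "c \<in> carrier R" "a \<in> carrier R"
            using lin(1,2) KyT KE(1) TE(1) by auto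
          from w(1) show "c \<otimes> y \<oplus> a = \<zero>"
          proof cases
            case zero
            then show ?thesis using w(2) u by simp
          next
            case (lin w' b)
            have w': "w' \<in> T" "w' \<in> carrier R" "b \<in> carrier R"
              using lin(2,3) DyT TE(1) DE(1) by auto
            \<comment> \<open>Here \<open>d\<close> compares the constant terms in \<open>y\<close>
              of the two sides, so it is \<open>y\<close> times an element \<open>z\<close> of
              \<open>T\<close>. A nonzero \<open>d\<close> would be invertible in \<open>T\<close>
              and would make \<open>y\<close> a unit. Hence \<open>d\<close> and \<open>z\<close>
              vanish, and z = 0 is the relation one degree lower, to which the induction hypothesis
              applies.\<close>
            define d where "d = a \<oplus> \<ominus> (u \<otimes> b)"
            have uT: "u \<in> T" using D(2) T(2) by blast
            have aD: "a \<in> D" using \<open>a \<in> K\<close> D(3) by blast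
            have dD: "d \<in> D"
              unfolding d_def using DE(5)[OF DE(6)[OF D(2) lin(3)]] DE(7) aD by blast
            have dc: "d \<in> carrier R" using dD DE(1) by blast
            define z where "z = u \<otimes> w' \<oplus> \<ominus> c"
            have zT: "z \<in> T"
              unfolding z_def using TE(5)[OF cT(1)] TE(6)[OF uT w'(1)] TE(7) by blast
            have zc: "z \<in> carrier R" using zT TE(1) by blast
            have "c \<otimes> y \<oplus> a = u \<otimes> (w' \<otimes> y \<oplus> b)"
              using w(2) lin(1) by simp
            then have "d = y \<otimes> z"
            proof -
              assume *: "c \<otimes> y \<oplus> a = u \<otimes> (w' \<otimes> y \<oplus> b)"
              have "d = (c \<otimes> y \<oplus> a) \<oplus> \<ominus> (c \<otimes> y) \<oplus> \<ominus> (u \<otimes> b)"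
                unfolding d_def using cT w' u y(1) by (simp add: a_ac r_neg r_neg1 r_neg2)
              also have "\<dots> = u \<otimes> (w' \<otimes> y \<oplus> b) \<oplus> \<ominus> (c \<otimes> y) \<oplus> \<ominus> (u \<otimes> b)"
                using * by simp
              also have "\<dots> = (y \<otimes> (u \<otimes> w') \<oplus> \<ominus> (y \<otimes> c)) \<oplus> (u \<otimes> b \<oplus> \<ominus> (u \<otimes> b))"
                using cT w' u y(1) by (simp add: r_distr a_ac m_ac)
              also have "\<dots> = y \<otimes> z"
                unfolding z_def using cT w' u y(1) by (simp add: r_distr r_neg r_minus)
              finally show ?thesis .
            qed
            have "d = \<zero>"
            proof (rule ccontr)
              assume "d \<noteq> \<zero>"
              then obtain e where e: "e \<in> T" "d \<otimes> e = \<one>"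
                using D_unit dD by blast
              have "y \<otimes> (z \<otimes> e) = \<one>"
                using e \<open>d = y \<otimes> z\<close> y(1) zc subring_mem_carrier[OF T(1) e(1)]
                by (simp add: m_assoc)
              then show False
                using no_unit TE(6)[OF zT e(1)] by blast
            qed
            then have "z = \<zero>"
              using \<open>d = y \<otimes> z\<close> y(1,3) zc integral by metis
            have "a = u \<otimes> b"
              using \<open>d = \<zero>\<close> cT(3) w'(3) u(1) eq_if_diff_zero[of a "u \<otimes> b"]
              unfolding d_def by simp
            moreover have "c = u \<otimes> w'"
              using \<open>z = \<zero>\<close> cT(2) w'(2) u(1) eq_if_diff_zero[of "u \<otimes> w'" c]
              unfolding z_def by simp
            ultimately have "a = \<zero>" "c = \<zero>"
              using K(2) lin(2,3) \<open>a \<in> K\<close> \<open>\<forall>w\<in>simple_extension D y. c = u \<otimes> w \<longrightarrow> c = \<zero>\<close>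
              unfolding free_over_def D_def by auto
            then show ?thesis
              using y(1) by simp
          qed
        qed
      qed simp
      \<comment> \<open>Polynomials in \<open>u\<close> over K[y] are also polynomials in
        \<open>y\<close> over K[u], the form in which \<open>key\<close> is stated. Freeness then
        puts \<open>y\<close> into the field \<open>K\<close> by maximality, so \<open>y\<close>
        would be a unit of \<open>T\<close> after all.\<close>
      have "free_over (simple_extension K y) u"
        unfolding free_over_def
      proof (intro ballI impI)
        fix w assume "w \<in> simple_extension (simple_extension K y) u"
          and uw: "u \<otimes> w \<in> simple_extension K y"
        then have "w \<in> simple_extension D y"
          using simple_extension_swap[OF K(1) y(1) u(1)] unfolding D_def by blast
        then show "u \<otimes> w = \<zero>"
          using key[OF uw] by blast
      qed
      then have "y \<in> K"
        using in_K[OF y(1)] by blast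
      then have "inv y \<in> T"
        using K_inv[OF _ y(3)] KT by blast
      then show False
        using no_unit inv_props(2)[OF y(1,3)] by blast
    qed
  qed
qed

end

section \<open>Fields algebraic over their prime field\<close>

context field
begin

text \<open>Take \<open>u\<close> = 2 over the image of the integers. An overring \<open>T\<close>
  as in the criterion inverts all nonzero integers. If \<open>T\<close> missed x, then 1/x would lie
  in \<open>T\<close>, and its algebraic relation makes a multiple of 1/x equal to a nonzero
  integer, so 1/x would be a unit of \<open>T\<close>.\<close>

lemma submaximal_if_char_0_algebraic:
  assumes char0: "\<And>k::nat. k > 0 \<Longrightarrow> [k] \<cdot> \<one> \<noteq> \<zero>"
    and alg: "\<And>x. \<lbrakk>x \<in> carrier R; x \<noteq> \<zero>\<rbrakk> \<Longrightarrow> \<not> free_over (prime_subring R) x"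
  shows "submaximal R"
proof -
  let ?P = "prime_subring R"
  have int_nz: "k = 0" if "[k] \<cdot> \<one> = \<zero>" for k :: int
  proof (rule ccontr)
    assume "k \<noteq> 0"
    have "[\<bar>k\<bar>] \<cdot> \<one> = \<zero>"
      using that prime_subring_int(2)[of k] by (cases "k \<ge> 0") auto
    then have "[(nat \<bar>k\<bar>)] \<cdot> \<one> = \<zero>"
      using add_pow_int_ge[of "\<bar>k\<bar>" R \<one>] by simp
    then show False
      using char0[of "nat \<bar>k\<bar>"] \<open>k \<noteq> 0\<close> by simp
  qed
  define u where "u = [(2::int)] \<cdot> \<one>"
  have u: "u \<in> carrier R" "u \<noteq> \<zero>" "u \<in> ?P"
    using int_nz[of 2] unfolding u_def prime_subring_def by auto
  note iu = inv_props[OF u(1,2)]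
  show ?thesis
  proof (rule submaximal_if_all_overrings_full)
    show "subring ?P R"
      by (rule prime_subring_subring)
    show "u \<in> ?P" "u \<noteq> \<zero>"
      using u by auto
    show "inv u \<notin> ?P"
    proof
      assume "inv u \<in> ?P"
      then obtain m :: int where m: "inv u = [m] \<cdot> \<one>"
        unfolding prime_subring_def by blast
      \<comment> \<open>If 1/2 were the integer m, the odd number 2m - 1 would vanish in a field of
        characteristic 0.\<close>
      have "[(2 * m + - 1)] \<cdot> \<one> = u \<otimes> inv u \<oplus> \<ominus> \<one>"
        unfolding m unfolding u_def
        using prime_subring_int(1)[of "2 * m" "- 1"] prime_subring_int(2)[of 1]
          prime_subring_int(3)[of 2 m] by simp
      then have "[(2 * m + - 1)] \<cdot> \<one> = \<zero>"
        using iu by (simp add: r_neg)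
      then have "2 * m + - 1 = 0"
        by (rule int_nz)
      then show False
        by presburger
    qed
    fix T assume T: "subring T R" "?P \<subseteq> T" "inv u \<in> T"
      and val: "\<And>x. \<lbrakk>x \<in> carrier R; x \<noteq> \<zero>\<rbrakk> \<Longrightarrow> x \<in> T \<or> inv x \<in> T"
      and unit: "\<And>v. v \<in> ?P \<Longrightarrow> \<exists>e\<in>T. (\<one> \<oplus> u \<otimes> v) \<otimes> e = \<one>"
    note TE = subringE[OF T(1)]
    \<comment> \<open>Odd integers have the form 1 + 2j and are units by \<open>unit\<close>; even
      ones give up a factor 2, whose inverse is in \<open>T\<close>.\<close>
    have inv_int: "\<exists>e\<in>T. [k] \<cdot> \<one> \<otimes> e = \<one>" if "k \<noteq> 0" for k :: int
      using that
    proof (induction "nat \<bar>k\<bar>" arbitrary: k rule: less_induct)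
      case less
      show ?case
      proof (cases "even k")
        case True
        then obtain j where j: "k = 2 * j" by blast
        then obtain e where e: "e \<in> T" "[j] \<cdot> \<one> \<otimes> e = \<one>"
          using less.hyps[of j] less.prems by fastforce
        have ec: "e \<in> carrier R" using e TE(1) by blast
        have "[k] \<cdot> \<one> \<otimes> (inv u \<otimes> e) = (u \<otimes> inv u) \<otimes> ([j] \<cdot> \<one> \<otimes> e)"
          using iu(1) ec u(1) prime_subring_int(3)[of 2 j] unfolding j u_def[symmetric]
          by (simp add: m_ac)
        then show ?thesis
          using iu e TE(6)[OF T(3) e(1)] by auto
      next
        case False
        then obtain j where j: "k = 1 + 2 * j" by (metis oddE add.commute)
        have "[j] \<cdot> \<one> \<in> ?P"
          unfolding prime_subring_def by blast
        then obtain e where "e \<in> T" "(\<one> \<oplus> u \<otimes> [j] \<cdot> \<one>) \<otimes> e = \<one>"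
          using unit by blast
        moreover have "[k] \<cdot> \<one> = \<one> \<oplus> u \<otimes> [j] \<cdot> \<one>"
          unfolding j u_def using prime_subring_int(1)[of 1 "2 * j"] prime_subring_int(3)[of 2 j]
          by simp
        ultimately show ?thesis by auto
      qed
    qed
    show "carrier R \<subseteq> T"
    proof (rule subsetI, rule ccontr)
      fix x assume x: "x \<in> carrier R" "x \<notin> T"
      have x0: "x \<noteq> \<zero>" using x(2) TE(2) by blast
      note y = inv_props[OF x(1) x0]
      have yT: "inv x \<in> T"
        using val[OF x(1) x0] x(2) by blast
      obtain w where w: "w \<in> simple_extension ?P (inv x)" "inv x \<otimes> w \<in> ?P" "inv x \<otimes> w \<noteq> \<zero>"
        using alg[OF y(1,3)] unfolding free_over_def by blast
      have wT: "w \<in> T"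
        using w(1) simple_extension_subring_incl[OF T(1,2) yT] by blast
      obtain k :: int where k: "inv x \<otimes> w = [k] \<cdot> \<one>"
        using w(2) unfolding prime_subring_def by blast
      have "k \<noteq> 0"
        using w(3) k add_pow_int_ge[of 0 R \<one>] by auto
      then obtain e where e: "e \<in> T" "inv x \<otimes> w \<otimes> e = \<one>"
        using inv_int k by metis
      have car: "w \<in> carrier R" "e \<in> carrier R"
        using wT e(1) TE(1) by auto
      have "x = x \<otimes> (inv x \<otimes> w \<otimes> e)"
        using e(2) x(1) by simp
      also have "\<dots> = (x \<otimes> inv x) \<otimes> (w \<otimes> e)"
        using x(1) y(1) car by (simp add: m_ac)
      also have "\<dots> = w \<otimes> e"
        using y(2) car by simp
      finally show False
        using x(2) TE(6)[OF wT e(1)] by simp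
    qed
  qed
qed

lemma prime_subring_char_p:
  assumes p: "normalization_semidom_class.prime (p::nat)" "[p] \<cdot> \<one> = \<zero>"
  shows "finite (prime_subring R)"
    and "\<And>c. \<lbrakk>c \<in> prime_subring R; c \<noteq> \<zero>\<rbrakk> \<Longrightarrow> inv c \<in> prime_subring R"
proof -
  have p0: "p > 0"
    using p(1) prime_gt_0_nat by blast
  have pz: "[(int p * k)] \<cdot> \<one> = \<zero>" for k :: int
    using prime_subring_int(3)[of "int p" k] p(2) add_pow_int_ge[of "int p" R \<one>] by simp
  have cong: "[k] \<cdot> \<one> = [(k mod int p)] \<cdot> \<one>" for k :: int
    using prime_subring_int(1)[of "int p * (k div int p)" "k mod int p"] pz by simp
  have "prime_subring R \<subseteq> (\<lambda>k::int. [k] \<cdot> \<one>) ` {0..<int p}"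
  proof
    fix c assume "c \<in> prime_subring R"
    then obtain k :: int where "c = [k] \<cdot> \<one>"
      unfolding prime_subring_def by blast
    then show "c \<in> (\<lambda>k::int. [k] \<cdot> \<one>) ` {0..<int p}"
      using cong[of k] p0 by auto
  qed
  then show "finite (prime_subring R)"
    using finite_subset by blast
  fix c assume c: "c \<in> prime_subring R" "c \<noteq> \<zero>"
  then obtain k :: int where k: "c = [k] \<cdot> \<one>"
    unfolding prime_subring_def by blast
  have "\<not> int p dvd k"
    using c(2) k pz by (auto simp: dvd_def)
  then have "coprime (int p) k"
    using p(1) by (intro prime_imp_coprime) auto
  then obtain a b where ab: "a * int p + b * k = 1"
    using bezout_int[of "int p" k] by (auto simp: coprime_iff_gcd_eq_1)
  have "c \<otimes> [b] \<cdot> \<one> = [(int p * a + b * k)] \<cdot> \<one>"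
    using prime_subring_int(1)[of "int p * a" "b * k"] pz prime_subring_int(3)[of k b]
    unfolding k by (simp add: mult.commute)
  also have "\<dots> = \<one>"
    using ab by (simp add: mult.commute)
  finally have "inv c = [b] \<cdot> \<one>"
    using inverse_unique[of c "[b] \<cdot> \<one>"] k by simp
  then show "inv c \<in> prime_subring R"
    unfolding prime_subring_def by blast
qed

lemma finite_poly_upto:
  assumes "finite S"
  shows "finite (poly_upto S x n)"
proof (induction n)
  case (Suc n)
  have "poly_upto S x (Suc n) = (\<lambda>(a, b). a \<oplus> x \<otimes> b) ` (S \<times> poly_upto S x n)"
    by auto
  then show ?case
    using Suc assms by simp
qed (use assms in simp)

lemma frobenius_inj:
  assumes p: "normalization_semidom_class.prime (p::nat)" "[p] \<cdot> \<one> = \<zero>"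
    and xy: "x \<in> carrier R" "y \<in> carrier R" "x [^] (p ^ m) = y [^] (p ^ m)"
  shows "x = y"
proof -
  have "(x \<oplus> \<ominus> y) [^] (p ^ m) = x [^] (p ^ m) \<oplus> \<ominus> (y [^] (p ^ m))"
    using frobenius_pow_add[OF p] frobenius_pow_uminus[OF p] xy(1,2) by simp
  then have "(x \<oplus> \<ominus> y) [^] (p ^ m) = \<zero>"
    using xy by (simp add: r_neg)
  moreover have "z [^] k \<noteq> \<zero>" if "z \<in> carrier R" "z \<noteq> \<zero>" for z and k :: nat
    by (induction k) (use that integral_iff in auto)
  ultimately have "x \<oplus> \<ominus> y = \<zero>"
    using xy(1,2) by (metis a_inv_closed add.m_closed)
  then show ?thesis
    using eq_if_diff_zero[OF xy(1,2)] by simp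
qed

text \<open>All powers of \<open>x\<close> lie in one finite module over the finite prime field, so
  two of the elements x^(p^i) and x^(p^j) coincide. Injectivity of the p^i-th power map cancels the
  smaller exponent.\<close>

lemma frobenius_periodic:
  assumes p: "normalization_semidom_class.prime (p::nat)" "[p] \<cdot> \<one> = \<zero>"
    and alg: "\<And>x. \<lbrakk>x \<in> carrier R; x \<noteq> \<zero>\<rbrakk> \<Longrightarrow> \<not> free_over (prime_subring R) x"
    and x: "x \<in> carrier R"
  shows "\<exists>m>0. x [^] (p ^ m) = x"
proof (cases "x = \<zero>")
  case True
  have "p > 0"
    using p(1) prime_gt_0_nat by blast
  then show ?thesis
    using True nat_pow_zero[of "p ^ 1"] by (intro exI[of _ 1]) simp
next
  case False
  let ?P = "prime_subring R"
  note P = prime_subring_subring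
  note y = inv_props[OF x False]
  \<comment> \<open>The relation is taken for 1/x: its nonzero constant term can be scaled to 1, and
    reversing it yields a monic relation for \<open>x\<close>, so that x^(n+1) reduces to lower
    powers.\<close>
  obtain w where w: "w \<in> simple_extension ?P (inv x)" "inv x \<otimes> w \<in> ?P" "inv x \<otimes> w \<noteq> \<zero>"
    using alg[OF y(1,3)] unfolding free_over_def by blast
  define c where "c = inv x \<otimes> w"
  have Q: "subring (simple_extension ?P (inv x)) R"
    using simple_extension_is_subring[OF P y(1)] .
  have wc: "w \<in> carrier R"
    using subring_mem_carrier[OF Q w(1)] .
  have c: "c \<in> ?P" "c \<in> carrier R" "c \<noteq> \<zero>"
    using w y(1) wc unfolding c_def by auto
  have ic: "inv c \<in> ?P"
    using prime_subring_char_p(2)[OF p c(1,3)] .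
  have icc: "inv c \<in> carrier R" "c \<otimes> inv c = \<one>"
    using inv_props[OF c(2,3)] by auto
  have "x = x \<otimes> (inv x \<otimes> w \<otimes> inv c)"
    using icc(2) x unfolding c_def by simp
  also have "\<dots> = (x \<otimes> inv x) \<otimes> (w \<otimes> inv c)"
    using x y(1) wc icc(1) by (simp add: m_ac)
  also have "\<dots> = w \<otimes> inv c"
    using y(2) wc icc(1) by simp
  finally have "x \<in> simple_extension ?P (inv x)"
    using subringE(6)[OF Q w(1)] ic simple_extension_incl[OF subringE(1)[OF P] y(1)] by auto
  then obtain n where "x \<in> poly_upto ?P (inv x) n"
    using simple_extension_poly_upto[OF P y(1)] by blast
  then have "x [^] n \<otimes> x \<in> poly_upto ?P x n"
    using poly_upto_reverse[OF P x y(1,2)] by blast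
  then have top: "x [^] Suc n \<in> poly_upto ?P x n"
    by simp
  have stable: "x \<otimes> b \<in> poly_upto ?P x n" if b: "b \<in> poly_upto ?P x n" for b
  proof -
    obtain d s where d: "d \<in> poly_upto ?P x n" "s \<in> ?P" "x \<otimes> b = d \<oplus> s \<otimes> x [^] Suc n"
      using poly_upto_top[OF P x poly_upto_times_x[OF P x b]] by blast
    then show ?thesis
      using poly_upto_add[OF P x d(1) poly_upto_smult[OF P x d(2) top]] by simp
  qed
  have powers: "x [^] k \<in> poly_upto ?P x n" for k :: nat
  proof (induction k)
    case 0
    show ?case
      using poly_upto_incl[OF P x subringE(3)[OF P]] by simp
  next
    case (Suc k)
    then show ?case
      using stable[OF Suc] x by (simp add: m_comm)
  qed
  then have "range (\<lambda>i. x [^] (p ^ i)) \<subseteq> poly_upto ?P x n"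
    by (intro image_subsetI)
  then have "finite (range (\<lambda>i. x [^] (p ^ i)))"
    using finite_subset[OF _ finite_poly_upto[OF prime_subring_char_p(1)[OF p]]] by simp
  then have "\<not> inj (\<lambda>i. x [^] (p ^ i))"
    using finite_imageD infinite_UNIV_nat by blast
  then obtain i j where ij: "i < j" "x [^] (p ^ i) = x [^] (p ^ j)"
    unfolding inj_def by (metis linorder_neqE_nat)
  define m where "m = j - i"
  have "(x [^] (p ^ m)) [^] (p ^ i) = x [^] (p ^ i)"
    using ij x unfolding m_def by (simp add: nat_pow_pow flip: power_add)
  then have "x [^] (p ^ m) = x"
    using frobenius_inj[OF p] x by simp
  then show ?thesis
    using ij(1) unfolding m_def by (intro exI[of _ "j - i"]) auto
qed

lemma ex_prime_characteristic:
  assumes "(k::nat) > 0" "[k] \<cdot> \<one> = \<zero>"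
  shows "\<exists>p::nat. normalization_semidom_class.prime p \<and> [p] \<cdot> \<one> = \<zero>"
proof -
  define p where "p = (LEAST k::nat. k > 0 \<and> [k] \<cdot> \<one> = \<zero>)"
  have p: "p > 0" "[p] \<cdot> \<one> = \<zero>"
    using LeastI[of "\<lambda>k::nat. k > 0 \<and> [k] \<cdot> \<one> = \<zero>" k] assms unfolding p_def by auto
  have least: "p \<le> j" if "j > 0" "[j] \<cdot> \<one> = \<zero>" for j :: nat
    using Least_le[of "\<lambda>k::nat. k > 0 \<and> [k] \<cdot> \<one> = \<zero>" j] that unfolding p_def by auto
  have "p \<noteq> 1"
    using p(2) by auto
  moreover have "a = 1 \<or> a = p" if "a dvd p" for a
  proof -
    obtain b where ab: "p = a * b" using \<open>a dvd p\<close> by blast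
    have "[a] \<cdot> \<one> \<otimes> [b] \<cdot> \<one> = [a] \<cdot> ([b] \<cdot> \<one>)"
      using add_pow_ldistr[of \<one> "[b] \<cdot> \<one>" a] by simp
    also have "\<dots> = \<zero>"
      using add.nat_pow_pow[of \<one> a b] p(2) ab by (simp add: mult.commute)
    finally have "[a] \<cdot> \<one> = \<zero> \<or> [b] \<cdot> \<one> = \<zero>"
      by (simp add: integral_iff)
    moreover have "0 < a" "0 < b"
      using ab p(1) by auto
    ultimately have "p \<le> a \<or> p \<le> b"
      using least by blast
    moreover have "a \<le> p" "b \<le> p"
      using ab p(1) by (auto intro!: dvd_imp_le)
    ultimately have "a = p \<or> b = p"
      by linarith
    then show ?thesis
      using ab p(1) by auto
  qed
  ultimately have "normalization_semidom_class.prime p"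
    using p(1) by (simp add: prime_nat_iff)
  then show ?thesis
    using p(2) by blast
qed

text \<open>A field with a transcendental element, or of characteristic 0, has a rank one valuation
  ring of the kind just built. What remains are algebraic extensions of finite prime fields.\<close>

lemma submaximal_or_frobenius_periodic:
  "submaximal R \<or> (\<exists>p::nat. normalization_semidom_class.prime p \<and> [p] \<cdot> \<one> = \<zero> \<and>
    (\<forall>x\<in>carrier R. \<exists>m>0. x [^] (p ^ m) = x))"
proof (cases "\<exists>x\<in>carrier R. x \<noteq> \<zero> \<and> free_over (prime_subring R) x")
  case True
  then show ?thesis
    using submaximal_if_free[OF prime_subring_subring] by blast
next
  case False
  then have alg: "\<And>x. \<lbrakk>x \<in> carrier R; x \<noteq> \<zero>\<rbrakk> \<Longrightarrow> \<not> free_over (prime_subring R) x"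
    by blast
  show ?thesis
  proof (cases "\<exists>k::nat. k > 0 \<and> [k] \<cdot> \<one> = \<zero>")
    case True
    then obtain p :: nat where "normalization_semidom_class.prime p" "[p] \<cdot> \<one> = \<zero>"
      using ex_prime_characteristic by blast
    then show ?thesis
      using frobenius_periodic[OF _ _ alg] by blast
  next
    case False
    then show ?thesis
      using submaximal_if_char_0_algebraic[OF _ alg] by blast
  qed
qed

end

section \<open>Maximal ideals of height at least 2\<close>

lemma (in ring_hom_ring) hom_add_pow:
  "x \<in> carrier R \<Longrightarrow> h ([(n::nat)] \<cdot>\<^bsub>R\<^esub> x) = [n] \<cdot>\<^bsub>S\<^esub> h x"
  by (induction n) (simp_all add: R.add.nat_pow_Suc S.add.nat_pow_Suc)

context cring
begin

lemma cring_idealI: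
  assumes "I \<subseteq> carrier R" "\<zero> \<in> I"
    and add: "\<And>x y. \<lbrakk>x \<in> I; y \<in> I\<rbrakk> \<Longrightarrow> x \<oplus> y \<in> I"
    and mult: "\<And>a x. \<lbrakk>a \<in> carrier R; x \<in> I\<rbrakk> \<Longrightarrow> a \<otimes> x \<in> I"
  shows "ideal I R"
proof (rule idealI[OF ring_axioms])
  show "subgroup I (add_monoid R)"
  proof (rule add.subgroupI)
    show "\<ominus> x \<in> I" if "x \<in> I" for x
    proof -
      have "\<ominus> x = (\<ominus> \<one>) \<otimes> x"
        using that assms(1) by (simp add: l_minus subset_iff)
      then show ?thesis
        using mult[of "\<ominus> \<one>" x] that by simp
    qed
  qed (use assms in auto)
  show "a \<otimes> x \<in> I" if "x \<in> I" "a \<in> carrier R" for x a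
    using mult that by blast
  then show "x \<otimes> a \<in> I" if "x \<in> I" "a \<in> carrier R" for x a
    using that assms(1) m_comm[of x a] by auto
qed

lemma Idl_insert:
  assumes "g \<in> carrier R" "G \<subseteq> carrier R"
  shows "Idl (insert g G) \<subseteq> {a \<otimes> g \<oplus> j | a j. a \<in> carrier R \<and> j \<in> Idl G}"
proof (rule genideal_minimal)
  interpret J: ideal "Idl G" R
    using genideal_ideal[OF assms(2)] .
  have self: "G \<subseteq> Idl G"
    using genideal_self[OF assms(2)] .
  show "ideal {a \<otimes> g \<oplus> j | a j. a \<in> carrier R \<and> j \<in> Idl G} R"
  proof (rule cring_idealI)
    show "{a \<otimes> g \<oplus> j | a j. a \<in> carrier R \<and> j \<in> Idl G} \<subseteq> carrier R"
      using assms(1) J.Icarr by auto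
    have "\<zero> = \<zero> \<otimes> g \<oplus> \<zero>"
      using assms(1) by simp
    then show "\<zero> \<in> {a \<otimes> g \<oplus> j | a j. a \<in> carrier R \<and> j \<in> Idl G}"
      using J.zero_closed by blast
  next
    fix x y
    assume "x \<in> {a \<otimes> g \<oplus> j | a j. a \<in> carrier R \<and> j \<in> Idl G}"
      "y \<in> {a \<otimes> g \<oplus> j | a j. a \<in> carrier R \<and> j \<in> Idl G}"
    then obtain a j b k where *: "x = a \<otimes> g \<oplus> j" "a \<in> carrier R" "j \<in> Idl G"
      "y = b \<otimes> g \<oplus> k" "b \<in> carrier R" "k \<in> Idl G"
      by blast
    then have "x \<oplus> y = (a \<oplus> b) \<otimes> g \<oplus> (j \<oplus> k)"
      using assms(1) J.Icarr by (simp add: l_distr a_ac)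
    then show "x \<oplus> y \<in> {a \<otimes> g \<oplus> j | a j. a \<in> carrier R \<and> j \<in> Idl G}"
      using * J.a_closed a_closed by blast
  next
    fix r x
    assume r: "r \<in> carrier R" and "x \<in> {a \<otimes> g \<oplus> j | a j. a \<in> carrier R \<and> j \<in> Idl G}"
    then obtain a j where *: "x = a \<otimes> g \<oplus> j" "a \<in> carrier R" "j \<in> Idl G"
      by blast
    then have "r \<otimes> x = (r \<otimes> a) \<otimes> g \<oplus> r \<otimes> j"
      using assms(1) r J.Icarr by (simp add: r_distr m_assoc)
    then show "r \<otimes> x \<in> {a \<otimes> g \<oplus> j | a j. a \<in> carrier R \<and> j \<in> Idl G}"
      using * r J.I_l_closed m_closed by blast
  qed
  have "g = \<one> \<otimes> g \<oplus> \<zero>" and "\<And>x. x \<in> G \<Longrightarrow> x = \<zero> \<otimes> g \<oplus> x"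
    using assms by auto
  then show "insert g G \<subseteq> {a \<otimes> g \<oplus> j | a j. a \<in> carrier R \<and> j \<in> Idl G}"
    using self J.zero_closed by blast
qed

text \<open>Frobenius is additive modulo \<open>I\<close> because p lies in \<open>I\<close>, and
  its positive powers kill M modulo \<open>I\<close> because products of two elements of
  \<open>M\<close> lie in \<open>I\<close>. The proper subring consists of the elements fixed modulo
  \<open>I\<close> by some power of Frobenius.\<close>

lemma submaximal_if_proper_square_ideal:
  assumes M: "ideal M R" "M = Idl F" "finite F" "F \<subseteq> carrier R"
    and I: "ideal I R" "I \<subset> M" "\<And>a b. \<lbrakk>a \<in> M; b \<in> M\<rbrakk> \<Longrightarrow> a \<otimes> b \<in> I"
    and p: "normalization_semidom_class.prime (p::nat)" "[p] \<cdot> \<one> \<in> I"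
    and periodic: "\<And>x. x \<in> carrier R \<Longrightarrow> \<exists>m>0. x [^] (p ^ m) \<ominus> x \<in> M"
  shows "submaximal R"
proof -
  interpret M: ideal M R by fact
  interpret I: ideal I R by fact
  define A where "A = R Quot I"
  define h where "h = (+>) I"
  interpret h: ring_hom_ring R A h
    unfolding A_def h_def by (rule I.rcos_ring_hom_ring)
  interpret A: cring A
    unfolding A_def by (rule I.quotient_is_cring) (rule is_cring)
  have h_eq: "h x = h y \<longleftrightarrow> x \<ominus> y \<in> I" if "x \<in> carrier R" "y \<in> carrier R" for x y
    unfolding h_def using quotient_eq_iff_same_a_r_cos[OF I(1) that] by blast
  have h_zero: "h x = \<zero>\<^bsub>A\<^esub> \<longleftrightarrow> x \<in> I" if "x \<in> carrier R" for x
    using h_eq[OF that zero_closed] that h.hom_zero by (simp add: minus_eq)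
  have pA: "[p] \<cdot>\<^bsub>A\<^esub> \<one>\<^bsub>A\<^esub> = \<zero>\<^bsub>A\<^esub>"
    using h.hom_add_pow[of \<one> p] h_zero[of "[p] \<cdot> \<one>"] p(2) by simp
  note frob = A.frobenius_pow_add[OF p(1) pA] A.frobenius_pow_uminus[OF p(1) pA]
  have p1: "p > 1"
    using p(1) prime_gt_1_nat by blast
  \<comment> \<open>Positivity of m gives p^m >= 2, so a product of two elements of \<open>M\<close>
    splits off.\<close>
  have nilp: "h x [^]\<^bsub>A\<^esub> (p ^ m) = \<zero>\<^bsub>A\<^esub>" if "x \<in> M" "m > 0" for x m
  proof -
    have "1 < p ^ m"
      using p1 that(2) by (intro one_less_power)
    then obtain k where k: "p ^ m = Suc (Suc k)"
      using less_imp_Suc_add[of 1 "p ^ m"] by auto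
    have xc: "x \<in> carrier R" using that(1) M.Icarr by blast
    have "x [^] (p ^ m) = x [^] k \<otimes> (x \<otimes> x)"
      unfolding k using xc by (simp add: m_assoc)
    also have "\<dots> \<in> I"
      using I.I_l_closed[OF I(3)] that(1) xc by simp
    finally show ?thesis
      using h_zero[of "x [^] (p ^ m)"] h.hom_nat_pow[OF xc] xc by simp
  qed
  \<comment> \<open>The exponent may depend on x: the residue field can be infinite, and then no
    single power of Frobenius fixes all of it.\<close>
  define S where "S = {x \<in> carrier R. \<exists>m>0. h x [^]\<^bsub>A\<^esub> (p ^ m) = h x}"
  have S_I: "x \<in> S" if "x \<in> carrier R" "m > 0" "h x [^]\<^bsub>A\<^esub> (p ^ m) = h x" for x m
    unfolding S_def using that by (intro CollectI conjI exI[of _ m])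
  have common: "\<exists>m>0. h x [^]\<^bsub>A\<^esub> (p ^ m) = h x \<and> h y [^]\<^bsub>A\<^esub> (p ^ m) = h y"
    if "x \<in> S" "y \<in> S" for x y
  proof -
    have x: "x \<in> carrier R" "\<exists>m>0. h x [^]\<^bsub>A\<^esub> (p ^ m) = h x"
      and y: "y \<in> carrier R" "\<exists>m>0. h y [^]\<^bsub>A\<^esub> (p ^ m) = h y"
      using that unfolding S_def by simp_all
    obtain m where m: "m > 0" "h x [^]\<^bsub>A\<^esub> (p ^ m) = h x"
      using x(2) by (elim exE conjE)
    obtain n where n: "n > 0" "h y [^]\<^bsub>A\<^esub> (p ^ n) = h y"
      using y(2) by (elim exE conjE)
    have "h x [^]\<^bsub>A\<^esub> (p ^ (m * n)) = h x" "h y [^]\<^bsub>A\<^esub> (p ^ (n * m)) = h y"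
      using A.iterate_pow_fixed x(1) y(1) m(2) n(2) by simp_all
    then show ?thesis
      using m(1) n(1) by (intro exI[of _ "m * n"]) (simp add: mult.commute)
  qed
  have S: "subring S R"
  proof (rule subringI)
    show "S \<subseteq> carrier R"
      unfolding S_def by blast
    show "\<one> \<in> S"
      by (rule S_I[of \<one> 1]) simp_all
    show "\<ominus> x \<in> S" if x: "x \<in> S" for x
    proof -
      obtain m where m: "m > 0" "h x [^]\<^bsub>A\<^esub> (p ^ m) = h x"
        using common[OF x x] by (elim exE conjE)
      have xc: "x \<in> carrier R"
        using x unfolding S_def by simp
      have "h (\<ominus> x) [^]\<^bsub>A\<^esub> (p ^ m) = h (\<ominus> x)"
        using m(2) frob(2)[OF h.hom_closed[OF xc]] xc by simp
      then show ?thesis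
        using S_I m(1) xc by simp
    qed
    fix x y assume xy: "x \<in> S" "y \<in> S"
    obtain m where m: "m > 0" "h x [^]\<^bsub>A\<^esub> (p ^ m) = h x" "h y [^]\<^bsub>A\<^esub> (p ^ m) = h y"
      using common[OF xy] by (elim exE conjE)
    have car: "x \<in> carrier R" "y \<in> carrier R"
      using xy unfolding S_def by simp_all
    have "h (x \<otimes> y) [^]\<^bsub>A\<^esub> (p ^ m) = h (x \<otimes> y)"
      using m car by (simp add: A.nat_pow_distrib)
    then show "x \<otimes> y \<in> S"
      using m(1) car S_I by simp
    have "h (x \<oplus> y) [^]\<^bsub>A\<^esub> (p ^ m) = h (x \<oplus> y)"
      using m car frob(1) by simp
    then show "x \<oplus> y \<in> S"
      using m(1) car S_I by simp
  qed
  have I_S: "I \<subseteq> S"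
  proof
    fix x assume x: "x \<in> I"
    then have "h x = \<zero>\<^bsub>A\<^esub>" "x \<in> carrier R" "h x [^]\<^bsub>A\<^esub> (p ^ 1) = \<zero>\<^bsub>A\<^esub>"
      using h_zero I.Icarr nilp[of x 1] I(2) by auto
    then show "x \<in> S"
      by (intro S_I[of x 1]) simp_all
  qed
  have S_M: "x \<in> I" if "x \<in> S" "x \<in> M" for x
  proof -
    have x: "x \<in> carrier R" "\<exists>m>0. h x [^]\<^bsub>A\<^esub> (p ^ m) = h x"
      using that(1) unfolding S_def by simp_all
    obtain m where "m > 0" "h x [^]\<^bsub>A\<^esub> (p ^ m) = h x"
      using x(2) by (elim exE conjE)
    then show ?thesis
      using nilp[OF that(2)] h_zero[OF x(1)] by simp
  qed
  \<comment> \<open>The representative of x in \<open>S\<close> is s = x^(p^m) itself. It differs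
    from x by an element of \<open>M\<close>, which the same power of Frobenius kills modulo
    \<open>I\<close>, so s and x have the same p^m-th power there, namely s.\<close>
  have S_plus_M: "\<exists>s\<in>S. \<exists>e\<in>M. x = s \<oplus> e" if x: "x \<in> carrier R" for x
  proof -
    obtain m where m: "m > 0" "x [^] (p ^ m) \<ominus> x \<in> M"
      using periodic[OF x] by blast
    define e where "e = x [^] (p ^ m) \<ominus> x"
    define s where "s = x [^] (p ^ m)"
    have e: "e \<in> M" "e \<in> carrier R"
      using m(2) M.Icarr unfolding e_def by auto
    have s: "s \<in> carrier R" "s = x \<oplus> e"
      using x unfolding s_def e_def by (auto simp: a_minus_def a_ac r_neg r_neg1 r_neg2)
    have "h s [^]\<^bsub>A\<^esub> (p ^ m) = h x [^]\<^bsub>A\<^esub> (p ^ m) \<oplus>\<^bsub>A\<^esub> h e [^]\<^bsub>A\<^esub> (p ^ m)"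
      using s x e frob(1) by simp
    also have "\<dots> = h s"
      using nilp[OF e(1) m(1)] x h.hom_nat_pow[OF x] unfolding s_def by simp
    finally have "s \<in> S"
      using s(1) m(1) S_I by blast
    moreover have "x = s \<oplus> \<ominus> e"
      using s(2) x e(2) by (simp add: a_assoc r_neg)
    ultimately show ?thesis
      using e(1) M.a_inv_closed by blast
  qed
  show ?thesis
  proof (rule submaximal_if_finitely_generated_over_proper_subring[OF ring_axioms S _ M(3,4)])
    show "S \<noteq> carrier R"
    proof
      assume "S = carrier R"
      then have "M \<subseteq> I"
        using S_M M.a_subset by blast
      then show False
        using I(2) by blast
    qed
    fix T assume T: "subring T R" "S \<subseteq> T" "F \<subseteq> T"
    note TE = subringE[OF T(1)]
    \<comment> \<open>Writing a ring element as s + e with s in \<open>S\<close> and e in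
      \<open>M\<close>, multiplication by s stays in \<open>T\<close>, and e times an element of
      \<open>M\<close> lies in \<open>I\<close>, hence in \<open>S\<close>. Thus the finitely many
      generators of \<open>M\<close> as an ideal already generate R over \<open>S\<close> as a
      ring.\<close>
    have "ideal (M \<inter> T) R"
    proof (rule cring_idealI)
      show "M \<inter> T \<subseteq> carrier R" "\<zero> \<in> M \<inter> T"
        using TE(1,2) M.zero_closed by auto
      show "x \<oplus> y \<in> M \<inter> T" if "x \<in> M \<inter> T" "y \<in> M \<inter> T" for x y
        using that TE(7) M.a_closed by blast
      fix a x assume a: "a \<in> carrier R" and x: "x \<in> M \<inter> T"
      obtain s e where se: "s \<in> S" "e \<in> M" "a = s \<oplus> e"
        using S_plus_M[OF a] by blast
      have xM: "x \<in> M" "x \<in> T" "x \<in> carrier R"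
        using x TE(1) by auto
      have car: "s \<in> carrier R" "e \<in> carrier R"
        using se M.Icarr subring_mem_carrier[OF S] by auto
      have "a \<otimes> x = s \<otimes> x \<oplus> e \<otimes> x"
        using se(3) car xM(3) by (simp add: l_distr)
      moreover have "s \<otimes> x \<in> T"
        using TE(6) se(1) T(2) xM(2) by blast
      moreover have "e \<otimes> x \<in> T"
        using I(3)[OF se(2) xM(1)] I_S T(2) by blast
      ultimately have "a \<otimes> x \<in> T"
        using TE(7) by simp
      then show "a \<otimes> x \<in> M \<inter> T"
        using M.I_l_closed[OF xM(1) a] by blast
    qed
    moreover have "F \<subseteq> M \<inter> T"
      using T(3) genideal_self[OF M(4)] M(2) by blast
    ultimately have "M \<subseteq> T"
      using genideal_minimal M(2) by blast
    then have "carrier R \<subseteq> T"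
      using S_plus_M TE(7) T(2) by blast
    then show "T = carrier R"
      using TE(1) by blast
  qed
qed

text \<open>Nakayama's lemma for \<open>M/qR\<close>, localized at \<open>M\<close>, by eliminating generators.\<close>

lemma cotangent_principal_imp_locally_principal:
  assumes M: "primeideal M R" and q: "q \<in> M"
    and all: "\<And>I. \<lbrakk>ideal I R; q \<in> I; \<And>a b. \<lbrakk>a \<in> M; b \<in> M\<rbrakk> \<Longrightarrow> a \<otimes> b \<in> I\<rbrakk> \<Longrightarrow> M \<subseteq> I"
    and G: "finite G" "G \<subseteq> M"
    and s: "s \<in> carrier R" "s \<notin> M" "\<And>x. x \<in> M \<Longrightarrow> s \<otimes> x \<in> Idl (insert q G)"
  shows "\<exists>t\<in>carrier R. t \<notin> M \<and> (\<forall>x\<in>M. t \<otimes> x \<in> Idl {q})"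
  using G s
proof (induction G arbitrary: s rule: finite_induct)
  case empty
  then show ?case by auto
next
  case (insert g G)
  interpret M: primeideal M R by fact
  have gc: "g \<in> carrier R" "g \<in> M"
    using insert.prems(1) M.Icarr by auto
  have qG: "insert q G \<subseteq> carrier R"
    using insert.prems(1) q M.Icarr by auto
  define J where "J = Idl (insert q G)"
  interpret J: ideal J R
    unfolding J_def by (rule genideal_ideal[OF qG])
  have qJ: "q \<in> J"
    using genideal_self[OF qG] unfolding J_def by blast
  have qc: "q \<in> carrier R"
    using q M.Icarr by blast
  note s = insert.prems(2,3)
  have decomp: "\<exists>a\<in>carrier R. \<exists>j\<in>J. s \<otimes> x = a \<otimes> g \<oplus> j" if "x \<in> M" for x
    using insert.prems(4)[OF that] Idl_insert[OF gc(1) qG]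
    unfolding J_def insert_commute[of q g] by blast
  \<comment> \<open>The coefficient of \<open>g\<close> is required to lie in \<open>M\<close>. This
    ideal contains \<open>q\<close> and all products of two elements of \<open>M\<close>, hence all
    of \<open>M\<close> by \<open>all\<close>. For x = g it gives (s - a) g in \<open>J\<close> with
    a in \<open>M\<close>, so \<open>g\<close> is eliminated at the cost of the denominator s - a,
    which is again outside \<open>M\<close>.\<close>
  define I where "I = {x \<in> carrier R. \<exists>a\<in>M. \<exists>j\<in>J. s \<otimes> x = a \<otimes> g \<oplus> j}"
  have "M \<subseteq> I"
  proof (rule all)
    show "ideal I R"
    proof (rule cring_idealI)
      show "I \<subseteq> carrier R"
        unfolding I_def by blast
      have "s \<otimes> \<zero> = \<zero> \<otimes> g \<oplus> \<zero>"
        using gc s by simp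
      then show "\<zero> \<in> I"
        unfolding I_def using M.zero_closed J.zero_closed by blast
    next
      fix x y assume "x \<in> I" "y \<in> I"
      then obtain a j b k where *: "x \<in> carrier R" "a \<in> M" "j \<in> J" "s \<otimes> x = a \<otimes> g \<oplus> j"
        "y \<in> carrier R" "b \<in> M" "k \<in> J" "s \<otimes> y = b \<otimes> g \<oplus> k"
        unfolding I_def by blast
      then have "s \<otimes> (x \<oplus> y) = (a \<oplus> b) \<otimes> g \<oplus> (j \<oplus> k)"
        using s(1) gc(1) M.Icarr J.Icarr by (simp add: r_distr l_distr a_ac)
      then show "x \<oplus> y \<in> I"
        unfolding I_def using * M.a_closed J.a_closed a_closed by blast
    next
      fix r x assume r: "r \<in> carrier R" and "x \<in> I"
      then obtain a j where *: "x \<in> carrier R" "a \<in> M" "j \<in> J" "s \<otimes> x = a \<otimes> g \<oplus> j"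
        unfolding I_def by blast
      have "s \<otimes> (r \<otimes> x) = r \<otimes> (s \<otimes> x)"
        using s(1) r * by (simp add: m_ac)
      also have "\<dots> = (r \<otimes> a) \<otimes> g \<oplus> r \<otimes> j"
        using * r gc(1) M.Icarr J.Icarr by (simp add: r_distr m_assoc)
      finally show "r \<otimes> x \<in> I"
        unfolding I_def using * r M.I_l_closed J.I_l_closed m_closed by blast
    qed
    have "s \<otimes> q = \<zero> \<otimes> g \<oplus> s \<otimes> q"
      using s(1) gc(1) qc by simp
    then show "q \<in> I"
      unfolding I_def using qc M.zero_closed J.I_l_closed[OF qJ s(1)] by blast
    fix b c assume bc: "b \<in> M" "c \<in> M"
    then obtain a j where *: "a \<in> carrier R" "j \<in> J" "s \<otimes> b = a \<otimes> g \<oplus> j"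
      using decomp by blast
    have car: "b \<in> carrier R" "c \<in> carrier R" "j \<in> carrier R"
      using bc M.Icarr * J.Icarr by auto
    have "s \<otimes> (b \<otimes> c) = (s \<otimes> b) \<otimes> c"
      using car s(1) by (simp add: m_assoc)
    also have "\<dots> = (a \<otimes> c) \<otimes> g \<oplus> j \<otimes> c"
      unfolding *(3) using car *(1) gc(1) by (simp add: l_distr r_distr m_ac)
    finally show "b \<otimes> c \<in> I"
      unfolding I_def using M.I_l_closed[OF bc(2) *(1)] J.I_r_closed[OF *(2) car(2)] car by blast
  qed
  then obtain a j where aj: "a \<in> M" "j \<in> J" "s \<otimes> g = a \<otimes> g \<oplus> j"
    using gc(2) unfolding I_def by blast
  have car: "a \<in> carrier R" "j \<in> carrier R"
    using aj M.Icarr J.Icarr by auto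
  define s1 where "s1 = s \<oplus> \<ominus> a"
  have s1: "s1 \<in> carrier R"
    using s(1) car unfolding s1_def by simp
  have s1M: "s1 \<notin> M"
  proof
    assume "s1 \<in> M"
    then have "s1 \<oplus> a \<in> M"
      using aj(1) M.a_closed by blast
    moreover have "s1 \<oplus> a = s"
      using s(1) car unfolding s1_def by (simp add: a_assoc l_neg)
    ultimately show False
      using s(2) by simp
  qed
  have s1g: "s1 \<otimes> g = j"
  proof -
    have "s1 \<otimes> g = s \<otimes> g \<oplus> \<ominus> (a \<otimes> g)"
      using s(1) car gc(1) unfolding s1_def by (simp add: l_distr l_minus)
    also have "\<dots> = j"
      unfolding aj(3) using car gc(1) by (simp add: a_ac r_neg r_neg1 r_neg2)
    finally show ?thesis .
  qed
  show ?case
  proof (rule insert.IH[of "s1 \<otimes> s"])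
    show "G \<subseteq> M"
      using insert.prems(1) by blast
    show "s1 \<otimes> s \<in> carrier R"
      using s1 s(1) by simp
    show "s1 \<otimes> s \<notin> M"
      using M.I_prime[OF s1 s(1)] s1M s(2) by blast
    fix x assume x: "x \<in> M"
    then obtain b k where *: "b \<in> carrier R" "k \<in> J" "s \<otimes> x = b \<otimes> g \<oplus> k"
      using decomp by blast
    have xc: "x \<in> carrier R" "k \<in> carrier R"
      using x M.Icarr * J.Icarr by auto
    have "s1 \<otimes> s \<otimes> x = s1 \<otimes> (s \<otimes> x)"
      using s1 s(1) xc by (simp add: m_assoc)
    also have "\<dots> = b \<otimes> (s1 \<otimes> g) \<oplus> s1 \<otimes> k"
      unfolding *(3) using s1 *(1) xc gc(1) by (simp add: r_distr m_ac)
    also have "\<dots> \<in> J"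
      unfolding s1g using J.a_closed[OF J.I_l_closed[OF aj(2) *(1)] J.I_l_closed[OF *(2) s1]] .
    finally show "s1 \<otimes> s \<otimes> x \<in> Idl (insert q G)"
      unfolding J_def .
  qed
qed

end

section \<open>A locally principal prime has height at most 1\<close>

text \<open>Up to a denominator s outside \<open>M\<close>, every element of \<open>M\<close> is a
  multiple of \<open>q\<close>. A prime \<open>P\<close> strictly below \<open>M\<close> cannot
  contain \<open>q\<close>, so dividing by \<open>q\<close> stays in \<open>P\<close>, and every y
  in \<open>P\<close> becomes divisible by all powers of \<open>q\<close> up to powers of s. The
  ascending chain condition rules this out for nonzero y.\<close>

lemma (in noetherian_domain) cotangent_principal_imp_height_le_1:
  assumes M: "primeideal M R" and P: "primeideal P R" "P \<subset> M" and q: "q \<in> M"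
    and all: "\<And>I. \<lbrakk>ideal I R; q \<in> I; \<And>a b. \<lbrakk>a \<in> M; b \<in> M\<rbrakk> \<Longrightarrow> a \<otimes> b \<in> I\<rbrakk> \<Longrightarrow> M \<subseteq> I"
  shows "P = {\<zero>}"
proof (rule ccontr)
  assume "P \<noteq> {\<zero>}"
  interpret M: primeideal M R by fact
  interpret P: primeideal P R by fact
  have qc: "q \<in> carrier R"
    using q M.Icarr by blast
  obtain F where F: "F \<subseteq> carrier R" "finite F" "M = Idl F"
    using finetely_gen[OF M.is_ideal] by blast
  have FM: "F \<subseteq> M"
    using genideal_self[OF F(1)] F(3) by blast
  have "\<exists>t\<in>carrier R. t \<notin> M \<and> (\<forall>x\<in>M. t \<otimes> x \<in> Idl {q})"
  proof (rule cotangent_principal_imp_locally_principal[OF M q _ F(2) FM one_closed])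
    show "\<one> \<notin> M"
      using M.one_imp_carrier M.I_notcarr by blast
    have "M \<subseteq> Idl (insert q F)"
      unfolding F(3) using F(1) qc by (intro subset_Idl_subset) auto
    then show "\<one> \<otimes> x \<in> Idl (insert q F)" if "x \<in> M" for x
      using that M.Icarr by auto
  qed (use all in blast)
  then obtain s where s: "s \<in> carrier R" "s \<notin> M" "\<And>x. x \<in> M \<Longrightarrow> s \<otimes> x \<in> Idl {q}"
    by blast
  have s': "\<exists>z\<in>carrier R. s \<otimes> x = z \<otimes> q" if "x \<in> M" for x
    using s(3)[OF that] cgenideal_eq_genideal[OF qc] unfolding cgenideal_def by auto
  have "q \<notin> P"
  proof
    assume "q \<in> P"
    have "x \<in> P" if x: "x \<in> M" for x
    proof -
      obtain z where "z \<in> carrier R" "s \<otimes> x = z \<otimes> q"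
        using s'[OF x] by blast
      then have "s \<otimes> x \<in> P"
        using P.I_l_closed[OF \<open>q \<in> P\<close>] by simp
      then show ?thesis
        using P.I_prime[OF s(1)] M.Icarr[OF x] s(2) P(2) by blast
    qed
    then show False
      using P(2) by blast
  qed
  then have step: "\<exists>z\<in>P. s \<otimes> x = q \<otimes> z" if x: "x \<in> P" for x
  proof -
    obtain z where z: "z \<in> carrier R" "s \<otimes> x = z \<otimes> q"
      using s'[of x] x P(2) by blast
    then have "z \<otimes> q \<in> P"
      using P.I_l_closed[OF x s(1)] by simp
    then have "z \<in> P"
      using P.I_prime[OF z(1) qc] \<open>q \<notin> P\<close> by blast
    then show ?thesis
      using z qc m_comm[OF z(1) qc] by (intro bexI[of _ z]) simp_all
  qed
  obtain y where y: "y \<in> P" "y \<noteq> \<zero>"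
    using \<open>P \<noteq> {\<zero>}\<close> P.zero_closed by blast
  have yc: "y \<in> carrier R"
    using y P.Icarr by blast
  have iter: "\<exists>z\<in>P. s [^] n \<otimes> y = q [^] n \<otimes> z" for n :: nat
  proof (induction n)
    case 0
    then show ?case using y yc by auto
  next
    case (Suc n)
    then obtain z where z: "z \<in> P" "s [^] n \<otimes> y = q [^] n \<otimes> z" by blast
    obtain z' where z': "z' \<in> P" "s \<otimes> z = q \<otimes> z'"
      using step[OF z(1)] by blast
    have car: "z \<in> carrier R" "z' \<in> carrier R"
      using z z' P.Icarr by auto
    have "s [^] Suc n \<otimes> y = s \<otimes> (s [^] n \<otimes> y)"
      using s(1) yc by (simp add: m_ac)
    also have "\<dots> = q [^] n \<otimes> (s \<otimes> z)"
      unfolding z(2) using s(1) qc car by (simp add: m_ac)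
    also have "\<dots> = q [^] Suc n \<otimes> z'"
      unfolding z'(2) using qc car by (simp add: m_ac)
    finally show ?case
      using z'(1) by blast
  qed
  \<comment> \<open>These are the ideals (yR : q^n), an ascending chain. Once it is stationary at N,
    the quotient of s^(N+1) y by q^(N+1) already lies in K N. Cancelling y then exhibits s^(N+1) as
    a multiple of \<open>q\<close>, although s lies outside the prime \<open>M\<close>.\<close>
  define K where "K n = {x \<in> carrier R. q [^] n \<otimes> x \<in> PIdl y}" for n :: nat
  interpret Y: ideal "PIdl y" R
    using cgenideal_ideal[OF yc] .
  have K_ideal: "ideal (K n) R" for n
  proof (rule cring_idealI)
    show "K n \<subseteq> carrier R" "\<zero> \<in> K n"
      using qc Y.zero_closed unfolding K_def by auto
    show "x \<oplus> z \<in> K n" if "x \<in> K n" "z \<in> K n" for x z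
      using that qc Y.a_closed unfolding K_def by (auto simp: r_distr)
    show "a \<otimes> x \<in> K n" if "a \<in> carrier R" "x \<in> K n" for a x
      using that qc Y.I_l_closed[of "q [^] n \<otimes> x" a] unfolding K_def by (auto simp: m_lcomm)
  qed
  have K_Suc: "K n \<subseteq> K (Suc n)" for n
  proof
    fix x assume "x \<in> K n"
    then have x: "x \<in> carrier R" "q [^] n \<otimes> x \<in> PIdl y"
      unfolding K_def by auto
    have "q [^] Suc n \<otimes> x = q \<otimes> (q [^] n \<otimes> x)"
      using x qc by (simp add: m_ac)
    then show "x \<in> K (Suc n)"
      using x Y.I_l_closed[OF x(2) qc] unfolding K_def by simp
  qed
  then have "K m \<subseteq> K n \<or> K n \<subseteq> K m" for m n
    using lift_Suc_mono_le[of K] nat_le_linear by metis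
  then have "subset.chain {I. ideal I R} (range K)"
    unfolding subset.chain_def using K_ideal by blast
  then have "\<Union>(range K) \<in> range K"
    by (intro ideal_chain_is_trivial) auto
  then obtain N where N: "\<Union>(range K) = K N"
    by blast
  obtain z where z: "z \<in> P" "s [^] Suc N \<otimes> y = q [^] Suc N \<otimes> z"
    using iter by blast
  have zc: "z \<in> carrier R"
    using z P.Icarr by blast
  have "s [^] Suc N \<otimes> y \<in> PIdl y"
    using s(1) unfolding cgenideal_def by blast
  then have "z \<in> K (Suc N)"
    using zc z(2) unfolding K_def by simp
  then have "z \<in> K N"
    using N by blast
  then obtain w where w: "w \<in> carrier R" "q [^] N \<otimes> z = w \<otimes> y"
    unfolding K_def cgenideal_def by blast
  have "q [^] Suc N \<otimes> z = q \<otimes> (q [^] N \<otimes> z)"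
    using qc zc by (simp add: m_ac)
  then have "s [^] Suc N \<otimes> y = (w \<otimes> q) \<otimes> y"
    unfolding z(2) w(2) using qc w(1) yc by (simp add: m_ac)
  then have "s [^] Suc N = w \<otimes> q"
    using m_rcancel[OF y(2) yc] s(1) w(1) qc by blast
  then have "s [^] Suc N \<in> M"
    using M.I_l_closed[OF q w(1)] by simp
  moreover have "s [^] k \<notin> M" for k :: nat
  proof (induction k)
    case 0
    show ?case
      using M.one_imp_carrier M.I_notcarr by auto
  next
    case (Suc k)
    then show ?case
      using M.I_prime[of "s [^] k" s] s(1,2) by auto
  qed
  ultimately show False
    by blast
qed

text \<open>In a noetherian ring the union of a nonempty chain of ideals is one of its members, so a
  chain of proper ideals has a proper union.\<close>

lemma (in noetherian_domain) exists_maximal_ideal: "\<exists>M. maximalideal M R"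
proof -
  define \<A> where "\<A> = {I. ideal I R \<and> I \<noteq> carrier R}"
  have "\<exists>M\<in>\<A>. \<forall>Y\<in>\<A>. M \<subseteq> Y \<longrightarrow> Y = M"
  proof (rule subset_Zorn_nonempty)
    show "\<A> \<noteq> {}"
      using zeroideal one_not_zero one_closed unfolding \<A>_def by blast
    fix \<C> assume \<C>: "\<C> \<noteq> {}" "subset.chain \<A> \<C>"
    then have "subset.chain {I. ideal I R} \<C>"
      unfolding subset.chain_def \<A>_def by blast
    then have "\<Union>\<C> \<in> \<C>"
      using ideal_chain_is_trivial[OF \<C>(1)] by blast
    then show "\<Union>\<C> \<in> \<A>"
      using \<C>(2) unfolding subset.chain_def by blast
  qed
  then obtain M where "M \<in> \<A>" and max: "\<forall>Y\<in>\<A>. M \<subseteq> Y \<longrightarrow> Y = M" by blast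
  then have M: "ideal M R" "M \<noteq> carrier R"
    unfolding \<A>_def by simp_all
  have "maximalideal M R"
  proof (rule maximalidealI[OF M(1)])
    show "carrier R \<noteq> M" using M(2) by simp
    show "J = M \<or> J = carrier R" if "ideal J R" "M \<subseteq> J" for J
      using max that unfolding \<A>_def by blast
  qed
  then show ?thesis ..
qed

text \<open>If all chains had length at most 1, so would their supremum. Of a longer chain only the
  last three members are kept.\<close>

lemma height_ge_2_imp_chain:
  assumes "height R M \<ge> 2"
  obtains C P where "primeideal C R" "primeideal P R" "C \<subset> P" "P \<subset> M"
proof -
  have "\<exists>k C. prime_chain_to R M k C \<and> k \<ge> 2"
  proof (rule ccontr)
    assume "\<not> ?thesis"
    then have "k \<le> 1" if "prime_chain_to R M k C" for k C
      using that by force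
    then have "height R M \<le> 1"
      unfolding height_def by (intro SUP_least) (auto simp: one_enat_def)
    with assms have "(2::enat) \<le> 1"
      by (rule order_trans)
    then show False
      by (simp add: one_enat_def numeral_eq_enat)
  qed
  then obtain k C where C: "prime_chain_to R M k C" "k \<ge> 2" by blast
  then obtain i where i: "k = Suc (Suc i)"
    by (metis Suc_le_D numeral_2_eq_2 Suc_le_mono)
  show thesis
    by (rule that[of "C i" "C (Suc i)"]) (use C(1) i in \<open>auto simp: prime_chain_to_def\<close>)
qed

lemma (in noetherian_domain) submaximal_if_height_ge_2:
  assumes M: "maximalideal M R" and ht: "height R M \<ge> 2"
  shows "submaximal R"
proof -
  interpret M: maximalideal M R by fact
  define k where "k = R Quot M"
  define h where "h = (+>) M"
  interpret k: field k
    unfolding k_def by (rule M.quotient_is_field) (rule is_cring)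
  interpret h: ring_hom_ring R k h
    unfolding k_def h_def by (rule M.rcos_ring_hom_ring)
  have h_eq: "h x = h y \<longleftrightarrow> x \<ominus> y \<in> M" if "x \<in> carrier R" "y \<in> carrier R" for x y
    unfolding h_def using quotient_eq_iff_same_a_r_cos[OF M.is_ideal that] by blast
  consider "submaximal k" | p :: nat where "normalization_semidom_class.prime p"
    "[p] \<cdot>\<^bsub>k\<^esub> \<one>\<^bsub>k\<^esub> = \<zero>\<^bsub>k\<^esub>" "\<forall>x\<in>carrier k. \<exists>m>0. x [^]\<^bsub>k\<^esub> (p ^ m) = x"
    using k.submaximal_or_frobenius_periodic by blast
  then show ?thesis
  proof cases
    case 1
    have "h ` carrier R = carrier k"
      unfolding k_def h_def FactRing_def A_RCOSETS_def' by auto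
    then show ?thesis
      using submaximal_surj_hom[OF h.is_ring_hom_ring _ 1] by blast
  next
    case (2 p)
    define q where "q = [p] \<cdot> \<one>"
    have qc: "q \<in> carrier R"
      unfolding q_def by simp
    have "h q = h \<zero>"
      unfolding q_def using h.hom_add_pow[of \<one> p] 2(2) by simp
    then have q: "q \<in> M"
      using h_eq[OF qc zero_closed] qc by (simp add: minus_eq)
    have periodic: "\<exists>m>0. x [^] (p ^ m) \<ominus> x \<in> M" if x: "x \<in> carrier R" for x
    proof -
      obtain m where "m > 0" "h x [^]\<^bsub>k\<^esub> (p ^ m) = h x"
        using bspec[OF 2(3) h.hom_closed[OF x]] by blast
      then show ?thesis
        using h_eq[of "x [^] (p ^ m)" x] h.hom_nat_pow[OF x] x by auto
    qed
    obtain F where F: "F \<subseteq> carrier R" "finite F" "M = Idl F"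
      using finetely_gen[OF M.is_ideal] by blast
    define I where "I = Idl (insert q {a \<otimes> b | a b. a \<in> M \<and> b \<in> M})"
    have gen: "insert q {a \<otimes> b | a b. a \<in> M \<and> b \<in> M} \<subseteq> M"
      using q M.I_l_closed M.Icarr by auto
    then have genc: "insert q {a \<otimes> b | a b. a \<in> M \<and> b \<in> M} \<subseteq> carrier R"
      using M.a_subset by blast
    have I: "ideal I R"
      unfolding I_def by (rule genideal_ideal[OF genc])
    have I_gen: "q \<in> I" "\<And>a b. \<lbrakk>a \<in> M; b \<in> M\<rbrakk> \<Longrightarrow> a \<otimes> b \<in> I"
      using genideal_self[OF genc] unfolding I_def by auto
    have "I \<subseteq> M"
      unfolding I_def by (rule genideal_minimal[OF M.is_ideal gen])
    have "I \<noteq> M"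
    proof
      assume "I = M"
      \<comment> \<open>As I = M, an ideal containing \<open>q\<close> and all products of two
        elements of \<open>M\<close> contains \<open>M\<close>. This is the Nakayama hypothesis that
        forces height at most 1.\<close>
      have all: "M \<subseteq> J"
        if "ideal J R" "q \<in> J" "\<And>a b. \<lbrakk>a \<in> M; b \<in> M\<rbrakk> \<Longrightarrow> a \<otimes> b \<in> J" for J
        using genideal_minimal[OF that(1), of "insert q {a \<otimes> b | a b. a \<in> M \<and> b \<in> M}"] that(2,3)
          \<open>I = M\<close> unfolding I_def by blast
      obtain C P where CP: "primeideal C R" "primeideal P R" "C \<subset> P" "P \<subset> M"
        using height_ge_2_imp_chain[OF ht] .
      \<comment> \<open>The middle prime of the chain must be zero, which leaves no room for a
        smaller prime, as that one also contains zero.\<close>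
      have "P = {\<zero>}"
        using cotangent_principal_imp_height_le_1[OF maximalideal_prime[OF M] CP(2,4) q] all by blast
      moreover have "\<zero> \<in> C"
        using additive_subgroup.zero_closed[OF ideal.axioms(1)[OF primeideal.axioms(1)[OF CP(1)]]] .
      ultimately show False
        using CP(3) by blast
    qed
    then show ?thesis
      using submaximal_if_proper_square_ideal[OF M.is_ideal F(3,2,1) I _ I_gen(2) 2(1)
          I_gen(1)[unfolded q_def] periodic] \<open>I \<subseteq> M\<close> by blast
  qed
qed

theorem theorem2p8:
  fixes R :: "('a, 'b) ring_scheme" and B :: "'a set" and n :: nat
  assumes "noetherian_domain R"
    and "has_trdeg R (prime_subring R) n"
    and "transcendence_basis R (prime_subring R) B"
    and "residually_algebraic (adjoin R (prime_subring R) B) R"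
    and "(ring_char R = 0 \<and> n \<ge> 1 \<and>
            (\<forall>M. maximalideal M R \<longrightarrow> height R M \<ge> enat (n + 1))) \<or>
         (ring_char R > 0 \<and> n \<ge> 2 \<and>
            (\<forall>M. maximalideal M R \<longrightarrow> height R M \<ge> enat n))"
  shows "submaximal R"
proof -
  obtain M where M: "maximalideal M R"
    using noetherian_domain.exists_maximal_ideal[OF assms(1)] by blast
  \<comment> \<open>The witness is n + 1 with n >= 1 in characteristic 0, and n >= 2 itself in
    positive characteristic.\<close>
  obtain k :: nat where "k \<ge> 2" "height R M \<ge> enat k"
    using assms(5) M by (metis Suc_eq_plus1 Suc_le_mono numeral_2_eq_2 One_nat_def)
  then have "height R M \<ge> 2"
    by (metis enat_ord_simps(1) numeral_eq_enat order_trans)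
  then show ?thesis
    using noetherian_domain.submaximal_if_height_ge_2[OF assms(1) M] by blast
qed

end
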